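(* Let $\Gamma$ be a reduced labelled oriented forest (LOF). If $I(\Gamma)$ or $T(\Gamma)$ has no cycles, then the standard $2$-complex $\mathcal{K}_{P(\Gamma)}$ of its associated presentation $P(\Gamma)$ has the non-positive immersion property.
   Context: A labelled oriented graph (LOG) $\Gamma$ consists of two (finite) sets $V(\Gamma)$ and $E(\Gamma)$ of vertices and edges, and three functions $i,t,\lambda:E(\Gamma)\to V(\Gamma)$ mapping each edge to its initial vertex, terminal vertex and label. A LOF (labelled oriented forest) is a LOG whose underlying graph is a forest. The associated presentation is $$P(\Gamma)=\langle V(\Gamma)\mid \{t(e)^{-1}\lambda(e)^{-1}i(e)\lambda(e): e\in E(\Gamma)\}\rangle,$$ i.e. it has a relation $i(e)\lambda(e)=\lambda(e)t(e)$ for each edge $e$. Reduced: $\Gamma$ is reduced if (i) $i(e)\neq\lambda(e)\neq t(e)$ for every edge $e$; (ii) no two distinct edges with the same label have the same initial vertex or the same terminal vertex; (iii) every vertex of degree one is the label of some edge. In particular all relators of $P(\Gamma)$ are cyclically reduced. The graphs $T(\Gamma)$ and $I(\Gamma)$ have vertex set $V(\Gamma)$ and one edge for each $e\in E(\Gamma)$ (multiple edges and loops count as cycles): one joins the first letters of the two sides of each relation $i(e)\lambda(e)=\lambda(e)t(e)$, namely $i(e)$ and $\lambda(e)$ (this is $T(\Gamma)$), and the other joins the last letters, namely $\lambda(e)$ and $t(e)$ (this is $I(\Gamma)$). The standard $2$-complex of a presentation has one $0$-cell, one $1$-cell for each generator and one $2$-cell for each relator, attached along the relator. Maps between $2$-complexes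 are combinatorial (open $n$-cells are sent homeomorphically onto open $n$-cells); an immersion is a locally injective such map. A $2$-complex $X$ has the non-positive immersion property if for every immersion $Y\to X$ with $Y$ compact and connected, either $\chi(Y)\le 0$ or $Y$ is contractible. *)

theory Defs
  imports "HOL-Analysis.Analysis" "HOL-Library.Disjoint_Sets"
begin

section \<open>Multigraphs\<close>

record ('v, 'e) multigraph =
  mverts :: "'v set"
  medges :: "'e set"
  mends :: "'e \<Rightarrow> 'v set"

text \<open>A cycle with edges \<open>es\<close> through the pairwise distinct vertices \<open>vs\<close>; the edge
  \<open>es ! k\<close> joins \<open>vs ! k\<close> to the cyclically next vertex. Loops are the cycles of length 1 and
  pairs of parallel edges the cycles of length 2.\<close>

definition is_cycle :: "('v, 'e) multigraph \<Rightarrow> 'v list \<Rightarrow> 'e list \<Rightarrow> bool" where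
  "is_cycle G vs es \<longleftrightarrow>
     es \<noteq> [] \<and> length vs = length es \<and> distinct es \<and> distinct vs \<and>
     set es \<subseteq> medges G \<and> set vs \<subseteq> mverts G \<and>
     (\<forall>k < length es. mends G (es ! k) = {vs ! k, vs ! (Suc k mod length es)})"

definition no_cycles :: "('v, 'e) multigraph \<Rightarrow> bool" where
  "no_cycles G \<longleftrightarrow> (\<nexists>vs es. is_cycle G vs es)"


section \<open>Labelled oriented graphs\<close>

record ('v, 'e) log =
  verts :: "'v set"
  edges :: "'e set"
  initial :: "'e \<Rightarrow> 'v"
  terminal :: "'e \<Rightarrow> 'v"
  label :: "'e \<Rightarrow> 'v"

definition is_log :: "('v, 'e) log \<Rightarrow> bool" where
  "is_log \<Gamma> \<longleftrightarrow> finite (verts \<Gamma>) \<and> finite (edges \<Gamma>) \<and>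
     initial \<Gamma> \<in> edges \<Gamma> \<rightarrow> verts \<Gamma> \<and> terminal \<Gamma> \<in> edges \<Gamma> \<rightarrow> verts \<Gamma> \<and> label \<Gamma> \<in> edges \<Gamma> \<rightarrow> verts \<Gamma>"

definition underlying_graph :: "('v, 'e) log \<Rightarrow> ('v, 'e) multigraph" where
  "underlying_graph \<Gamma> =
     \<lparr>mverts = verts \<Gamma>, medges = edges \<Gamma>, mends = (\<lambda>e. {initial \<Gamma> e, terminal \<Gamma> e})\<rparr>"

definition T_graph :: "('v, 'e) log \<Rightarrow> ('v, 'e) multigraph" where
  "T_graph \<Gamma> =
     \<lparr>mverts = verts \<Gamma>, medges = edges \<Gamma>, mends = (\<lambda>e. {initial \<Gamma> e, label \<Gamma> e})\<rparr>"

definition I_graph :: "('v, 'e) log \<Rightarrow> ('v, 'e) multigraph" where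
  "I_graph \<Gamma> =
     \<lparr>mverts = verts \<Gamma>, medges = edges \<Gamma>, mends = (\<lambda>e. {label \<Gamma> e, terminal \<Gamma> e})\<rparr>"

definition is_lof :: "('v, 'e) log \<Rightarrow> bool" where
  "is_lof \<Gamma> \<longleftrightarrow> is_log \<Gamma> \<and> no_cycles (underlying_graph \<Gamma>)"

text \<open>A loop contributes 2 to the degree of its vertex.\<close>

definition log_degree :: "('v, 'e) log \<Rightarrow> 'v \<Rightarrow> nat" where
  "log_degree \<Gamma> v = card {e \<in> edges \<Gamma>. initial \<Gamma> e = v} + card {e \<in> edges \<Gamma>. terminal \<Gamma> e = v}"

definition reduced_log :: "('v, 'e) log \<Rightarrow> bool" where
  "reduced_log \<Gamma> \<longleftrightarrow>
     (\<forall>e \<in> edges \<Gamma>. initial \<Gamma> e \<noteq> label \<Gamma> e \<and> label \<Gamma> e \<noteq> terminal \<Gamma> e) \<and>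
     (\<forall>e \<in> edges \<Gamma>. \<forall>e' \<in> edges \<Gamma>. e \<noteq> e' \<and> label \<Gamma> e = label \<Gamma> e' \<longrightarrow>
        initial \<Gamma> e \<noteq> initial \<Gamma> e' \<and> terminal \<Gamma> e \<noteq> terminal \<Gamma> e') \<and>
     (\<forall>v \<in> verts \<Gamma>. log_degree \<Gamma> v = 1 \<longrightarrow> (\<exists>e \<in> edges \<Gamma>. label \<Gamma> e = v))"


section \<open>Presentations\<close>

text \<open>In a word, the letter \<open>(g, True)\<close> stands for \<open>g\<close> and \<open>(g, False)\<close> for its inverse.\<close>

type_synonym 'g word = "('g \<times> bool) list"

record 'g presentation =
  gens :: "'g set"
  rels :: "'g word set"

definition log_relator :: "('v, 'e) log \<Rightarrow> 'e \<Rightarrow> 'v word" where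
  "log_relator \<Gamma> e =
     [(terminal \<Gamma> e, False), (label \<Gamma> e, False), (initial \<Gamma> e, True), (label \<Gamma> e, True)]"

definition log_presentation :: "('v, 'e) log \<Rightarrow> 'v presentation" where
  "log_presentation \<Gamma> = \<lparr>gens = verts \<Gamma>, rels = log_relator \<Gamma> ` edges \<Gamma>\<rparr>"


section \<open>2-complexes\<close>

text \<open>A space together with its sets of open \<open>n\<close>-cells.\<close>

record 'a cell_complex =
  cspace :: "'a topology"
  cells :: "nat \<Rightarrow> 'a set set"

text \<open>\<open>\<phi>\<close> is a characteristic map, defined on the closed ball \<open>D\<close>, of the open cell \<open>c\<close>, and \<open>K\<close>
  is the skeleton that receives the boundary.\<close>

definition characteristic_map ::
    "'a topology \<Rightarrow> 'd::topological_space set \<Rightarrow> 'a set \<Rightarrow> 'a set \<Rightarrow> ('d \<Rightarrow> 'a) \<Rightarrow> bool" where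
  "characteristic_map X D K c \<phi> \<longleftrightarrow>
     continuous_map (top_of_set D) X \<phi> \<and>
     homeomorphic_map (top_of_set (interior D)) (subtopology X c) \<phi> \<and>
     \<phi> ` frontier D \<subseteq> K"

text \<open>CW complexes of dimension at most 2. The last two conditions are closure finiteness and
  the weak topology.\<close>

definition is_two_complex :: "'a cell_complex \<Rightarrow> bool" where
  "is_two_complex X \<longleftrightarrow>
     Hausdorff_space (cspace X) \<and>
     (\<forall>n > 2. cells X n = {}) \<and>
     partition_on (topspace (cspace X)) (\<Union>n. cells X n) \<and>
     (\<forall>c \<in> cells X 0. \<exists>x. c = {x}) \<and>
     (\<forall>c \<in> cells X 1. \<exists>\<phi> :: real \<Rightarrow> 'a.
        characteristic_map (cspace X) {0..1} (\<Union>(cells X 0)) c \<phi>) \<and>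
     (\<forall>c \<in> cells X 2. \<exists>\<phi> :: complex \<Rightarrow> 'a.
        characteristic_map (cspace X) (cball 0 1) (\<Union>(cells X 0 \<union> cells X 1)) c \<phi>) \<and>
     (\<forall>c \<in> (\<Union>n. cells X n). finite {d \<in> (\<Union>n. cells X n). d \<inter> (cspace X closure_of c) \<noteq> {}}) \<and>
     (\<forall>A \<subseteq> topspace (cspace X).
        (\<forall>c \<in> (\<Union>n. cells X n). closedin (cspace X) (A \<inter> (cspace X closure_of c))) \<longrightarrow>
        closedin (cspace X) A)"

text \<open>Meaningful for complexes with finitely many cells, in particular for compact ones.\<close>

definition euler_char :: "'a cell_complex \<Rightarrow> int" where
  "euler_char X = int (card (cells X 0)) - int (card (cells X 1)) + int (card (cells X 2))"

definition combinatorial_map :: "'a cell_complex \<Rightarrow> 'b cell_complex \<Rightarrow> ('a \<Rightarrow> 'b) \<Rightarrow> bool" where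
  "combinatorial_map Y X f \<longleftrightarrow>
     continuous_map (cspace Y) (cspace X) f \<and>
     (\<forall>n. \<forall>c \<in> cells Y n. f ` c \<in> cells X n \<and>
        homeomorphic_map (subtopology (cspace Y) c) (subtopology (cspace X) (f ` c)) f)"

definition immersion :: "'a cell_complex \<Rightarrow> 'b cell_complex \<Rightarrow> ('a \<Rightarrow> 'b) \<Rightarrow> bool" where
  "immersion Y X f \<longleftrightarrow> combinatorial_map Y X f \<and>
     (\<forall>y \<in> topspace (cspace Y). \<exists>U. openin (cspace Y) U \<and> y \<in> U \<and> inj_on f U)"

text \<open>HOL cannot quantify over types inside a formula, so the type of the points of \<open>Y\<close> is a
  parameter. A theorem that leaves \<open>'y\<close> free covers all \<open>Y\<close>.\<close>

definition nonpositive_immersions :: "'y itself \<Rightarrow> 'a cell_complex \<Rightarrow> bool" where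
  "nonpositive_immersions TYPE('y) X \<longleftrightarrow>
     (\<forall>(Y :: 'y cell_complex) f.
        is_two_complex Y \<and> compact_space (cspace Y) \<and> connected_space (cspace Y) \<and>
        immersion Y X f \<longrightarrow>
        euler_char Y \<le> 0 \<or> contractible_space (cspace Y))"


section \<open>The standard 2-complex of a presentation\<close>

text \<open>The quotient of a disjoint union of a point, intervals and discs is represented on the
  disjoint union of the open cells, with the topology coinduced by the characteristic maps.\<close>

datatype 'g std_point = Base | On_edge 'g real | On_face "'g word" complex

definition edge_map :: "'g \<Rightarrow> real \<Rightarrow> 'g std_point" where
  "edge_map g x = (if 0 < x \<and> x < 1 then On_edge g x else Base)"

text \<open>The closed path spelled by \<open>w\<close>, parametrised by \<open>0 \<le> s < 1\<close>; each letter takes the same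
  time.\<close>

definition word_loop :: "'g word \<Rightarrow> real \<Rightarrow> 'g std_point" where
  "word_loop w s =
     (if w = [] then Base
      else let x = s * real (length w); (g, b) = w ! nat \<lfloor>x\<rfloor>
           in edge_map g (if b then frac x else 1 - frac x))"

definition face_map :: "'g word \<Rightarrow> complex \<Rightarrow> 'g std_point" where
  "face_map r z = (if norm z < 1 then On_face r z else word_loop r (Arg2pi z / (2 * pi)))"

definition std_cells :: "'g presentation \<Rightarrow> nat \<Rightarrow> 'g std_point set set" where
  "std_cells P n =
     (if n = 0 then {{Base}}
      else if n = 1 then (\<lambda>g. On_edge g ` {0<..<1}) ` gens P
      else if n = 2 then (\<lambda>r. On_face r ` ball 0 1) ` rels P
      else {})"

definition std_open :: "'g presentation \<Rightarrow> 'g std_point set \<Rightarrow> bool" where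
  "std_open P U \<longleftrightarrow>
     U \<subseteq> (\<Union>n. \<Union>(std_cells P n)) \<and>
     (\<forall>g \<in> gens P. openin (top_of_set {0..1}) {x \<in> {0..1}. edge_map g x \<in> U}) \<and>
     (\<forall>r \<in> rels P. openin (top_of_set (cball 0 1)) {z \<in> cball 0 1. face_map r z \<in> U})"

definition standard_complex :: "'g presentation \<Rightarrow> 'g std_point cell_complex" where
  "standard_complex P = \<lparr>cspace = topology (std_open P), cells = std_cells P\<rparr>"

lemma istopology_std_open: "istopology (std_open P)"
  unfolding istopology_def
proof (intro conjI allI impI)
  fix S T assume ST: "std_open P S" "std_open P T"
  have *: "{x \<in> A. f x \<in> S \<inter> T} = {x \<in> A. f x \<in> S} \<inter> {x \<in> A. f x \<in> T}"
    for A and f :: "'c \<Rightarrow> 'a std_point" by auto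
  show "std_open P (S \<inter> T)"
    unfolding std_open_def *
  proof (intro conjI ballI openin_Int)
    show "S \<inter> T \<subseteq> (\<Union>n. \<Union>(std_cells P n))"
      using ST(1) unfolding std_open_def by (meson le_infI1)
  qed (use ST in \<open>simp_all add: std_open_def\<close>)
next
  fix \<K> assume K: "\<forall>K\<in>\<K>. std_open P K"
  have *: "{x \<in> A. f x \<in> \<Union>\<K>} = \<Union>((\<lambda>K. {x \<in> A. f x \<in> K}) ` \<K>)"
    for A and f :: "'c \<Rightarrow> 'a std_point" by auto
  show "std_open P (\<Union>\<K>)"
    unfolding std_open_def *
  proof (intro conjI ballI openin_Union)
    show "\<Union>\<K> \<subseteq> (\<Union>n. \<Union>(std_cells P n))"
      using K unfolding std_open_def by (meson Union_least)
  qed (use K in \<open>force simp: std_open_def\<close>)+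
qed

lemma openin_standard_complex: "openin (cspace (standard_complex P)) = std_open P"
  by (simp add: standard_complex_def topology_inverse'[OF istopology_std_open])

end

theory Submission
  imports Defs "HOL-Computational_Algebra.Polynomial"
begin

text \<open>Let \<open>Y\<close> be a compact connected complex immersed in the standard complex. Local
  injectivity determines a face of \<open>Y\<close> by its image and one of its corners, so the faces of \<open>Y\<close>
  that start at a vertex \<open>v\<close>, regarded as edges between the two sides leaving \<open>v\<close>, embed into
  \<open>T(\<Gamma>)\<close> and form a forest. (For \<open>I(\<Gamma>)\<close> the orientation is reversed.) Let every edge of \<open>Y\<close>
  act by multiplication with \<open>X\<close> on the coefficients \<open>int[X]\<close>. The forest condition makes the
  boundary of faces injective at \<open>X = 0\<close>, hence injective. If the coboundary of vertices is
  injective as well, then \<open>|V| + |F| \<le> |E|\<close>. Otherwise minus the degree of a kernel element is a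
  height function on the vertices. In the latter case a leaf of the forest at a lowest face is a free edge,
  so \<open>Y\<close> collapses onto a connected graph, and this is a tree unless \<open>\<chi>(Y) \<le> 0\<close>.\<close>

section \<open>Cycle-free graphs and square complexes\<close>

text \<open>Sending every generator of a LOG presentation to 1 respects its relations, and letting
  edges act by \<open>X\<close> amounts to working in the resulting infinite cyclic cover.
  Polynomials are preferred to Laurent polynomials because the argument needs both evaluation at
  \<open>X = 0\<close> and a degree. The count of cells avoids ranks: since the boundary of a
  boundary is zero, images of coboundary and boundary are orthogonal, and in the ordered ring
  \<open>int[X]\<close> a vanishing sum of squares is trivial, so the two images meet only in 0. The
  topological obstacle is that the CW structure on \<open>Y\<close> comes with characteristic maps
  unrelated to the relators, so a face has no sides to speak of. They are replaced by lifts of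
  \<open>edge_map\<close> and \<open>face_map\<close> through the immersion. Extending such a lift
  from an open cell to its boundary relies on finite fibres; both this extension and the finiteness
  use that the standard complex is Hausdorff.\<close>

lemma homogeneous_system_nontrivial_solution:
  fixes A :: "'i \<Rightarrow> 'j \<Rightarrow> 'a::idom"
  assumes "finite I" "finite J" "card I < card J"
  shows "\<exists>x. (\<exists>j\<in>J. x j \<noteq> 0) \<and> (\<forall>i\<in>I. (\<Sum>j\<in>J. A i j * x j) = 0)"
  using assms
proof (induction I arbitrary: J A rule: finite_induct)
  case empty
  then obtain j where "j \<in> J" by (metis card.empty card_gt_0_iff ex_in_conv)
  then show ?case by (intro exI[of _ "\<lambda>_. 1"]) auto
next
  case (insert i0 I)
  show ?case
  proof (cases "\<forall>j\<in>J. A i0 j = 0")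
    case True
    with insert.IH[of J A] insert.prems insert.hyps show ?thesis by auto
  next
    case False
    then obtain p where p: "p \<in> J" "A i0 p \<noteq> 0" by auto
    have "card I < card (J - {p})" using insert.prems insert.hyps p by simp
    from insert.IH[OF _ this, of "\<lambda>i j. A i0 p * A i j - A i p * A i0 j"] insert.prems
    obtain y where y: "\<exists>j\<in>J - {p}. y j \<noteq> 0"
      "\<And>i. i \<in> I \<Longrightarrow> (\<Sum>j\<in>J - {p}. (A i0 p * A i j - A i p * A i0 j) * y j) = 0" by auto
    \<comment> \<open>Back substitution without division: the other unknowns are scaled by the pivot
      \<open>A i0 p\<close>, and row \<open>i0\<close> then forces \<open>x p\<close>. A nonzero
      entry stays nonzero since there are no zero divisors.\<close>
    define x where "x j = (if j = p then - (\<Sum>j\<in>J - {p}. A i0 j * y j) else A i0 p * y j)" for j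
    have sum_x: "(\<Sum>j\<in>J. A i j * x j) = (\<Sum>j\<in>J - {p}. (A i0 p * A i j - A i p * A i0 j) * y j)" for i
    proof -
      have "(\<Sum>j\<in>J. A i j * x j) = A i p * x p + (\<Sum>j\<in>J - {p}. A i j * x j)"
        using p insert.prems by (simp add: sum.remove)
      also have "\<dots> = - (\<Sum>j\<in>J - {p}. A i p * (A i0 j * y j)) + (\<Sum>j\<in>J - {p}. A i j * (A i0 p * y j))"
        by (simp add: x_def sum_distrib_left)
      also have "\<dots> = (\<Sum>j\<in>J - {p}. (A i0 p * A i j - A i p * A i0 j) * y j)"
        by (simp add: sum_subtractf[symmetric] algebra_simps)
      finally show ?thesis .
    qed
    have "\<exists>j\<in>J. x j \<noteq> 0" using y(1) p unfolding x_def by auto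
    moreover have "\<forall>i\<in>insert i0 I. (\<Sum>j\<in>J. A i j * x j) = 0"
      unfolding sum_x using y(2) by (auto simp: algebra_simps)
    ultimately show ?thesis by blast
  qed
qed

lemma no_cycles_no_loop:
  assumes "no_cycles G" "e \<in> medges G" "mends G e = {u, v}" "u \<in> mverts G"
  shows "u \<noteq> v"
proof
  assume "u = v"
  then have "is_cycle G [u] [e]" using assms by (simp add: is_cycle_def)
  then show False using assms(1) unfolding no_cycles_def by blast
qed

text \<open>Without a leaf, a walk can leave each vertex it reaches by an edge other than the one it
  came by. Finitely many vertices force a repetition, and the earliest repetition closes a
  cycle.\<close>

lemma no_cycles_leaf:
  assumes G: "no_cycles G" and S: "finite S" "S \<subseteq> medges G" "S \<noteq> {}"
    and ends: "\<And>e. e \<in> S \<Longrightarrow> \<exists>u\<in>mverts G. \<exists>v\<in>mverts G. mends G e = {u, v}"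
  shows "\<exists>e\<in>S. \<exists>v\<in>mends G e. \<forall>e'\<in>S - {e}. v \<notin> mends G e'"
proof (rule ccontr)
  assume no_leaf: "\<not> ?thesis"
  \<comment> \<open>A state pairs the current vertex with the edge along which the walk will leave
    it.\<close>
  define ok where "ok p \<longleftrightarrow> snd p \<in> S \<and> fst p \<in> mends G (snd p)" for p
  define step where
    "step p q \<longleftrightarrow> snd p \<noteq> snd q \<and> fst p \<noteq> fst q \<and> mends G (snd p) = {fst p, fst q}" for p q
  obtain e0 u0 where "e0 \<in> S" "u0 \<in> mends G e0" using S(3) ends by blast
  then have "ok (u0, e0)" by (simp add: ok_def)
  then have start: "\<exists>p. ok p" ..
  have next_step: "\<exists>q. ok q \<and> step p q" if "ok p" for p
  proof -
    obtain u where u: "mends G (snd p) = {fst p, u}" "fst p \<in> mverts G" "u \<in> mverts G"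
      using ends[of "snd p"] \<open>ok p\<close> unfolding ok_def by (metis empty_iff insertE insert_commute)
    have "fst p \<noteq> u" using no_cycles_no_loop[OF G _ u(1,2)] \<open>ok p\<close> S(2) unfolding ok_def by auto
    moreover obtain e' where "e' \<in> S - {snd p}" "u \<in> mends G e'"
      using no_leaf \<open>ok p\<close> u(1) unfolding ok_def by blast
    ultimately have "ok (u, e') \<and> step p (u, e')" using u unfolding ok_def step_def by auto
    then show ?thesis by blast
  qed
  obtain w where w: "\<And>n. ok (w n)" "\<And>n. step (w n) (w (Suc n))"
    using dependent_nat_choice[of "\<lambda>_. ok" "\<lambda>_. step"] start next_step by metis
  define v where "v n = fst (w n)" for n
  define e where "e n = snd (w n)" for n
  have e: "e n \<in> S" "e n \<noteq> e (Suc n)" "mends G (e n) = {v n, v (Suc n)}" for n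
    using w[of n] by (simp_all add: ok_def step_def v_def e_def)
  have v: "v n \<in> mverts G" for n
  proof -
    have "v n \<in> mends G (e n)" using e(3) by simp
    then show ?thesis using ends[OF e(1)[of n]] by auto
  qed
  have "finite (\<Union>(mends G ` S))" using S(1) ends by (metis (no_types) finite.emptyI finite_UN finite_insert)
  moreover have "range v \<subseteq> \<Union>(mends G ` S)" using e by blast
  ultimately have "\<not> inj v" using finite_imageD finite_subset infinite_UNIV_nat by blast
  then have "\<exists>j. \<exists>i<j. v i = v j" unfolding inj_def by (metis linorder_neqE_nat)
  then obtain j where j: "\<exists>i<j. v i = v j" and min: "\<And>j'. j' < j \<Longrightarrow> \<not> (\<exists>i<j'. v i = v j')"
    using exists_least_iff[of "\<lambda>j. \<exists>i<j. v i = v j"] by auto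
  from j obtain i where i: "i < j" "v i = v j" by blast
  have inj_v: "inj_on v {i..<j}"
    by (rule linorder_inj_onI) (use min in auto)
  \<comment> \<open>An edge used twice between distinct vertices would have to be crossed back and
    forth in consecutive steps, which the walk excludes.\<close>
  have e_less: "e k \<noteq> e l" if "i \<le> k" "k < l" "l < j" for k l
  proof
    assume "e k = e l"
    then have eq: "{v k, v (Suc k)} = {v l, v (Suc l)}" using e(3) by metis
    have "v k \<noteq> v l" using inj_v that unfolding inj_on_def by force
    then have kl: "v k = v (Suc l)" "v (Suc k) = v l" using eq by (auto simp: doubleton_eq_iff)
    have "Suc k = l" using inj_onD[OF inj_v kl(2)] that by auto
    moreover have "Suc l = j"
    proof (rule ccontr)
      assume "Suc l \<noteq> j"
      then have "k = Suc l" using inj_onD[OF inj_v kl(1)] that by auto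
      then show False using that by simp
    qed
    ultimately show False using \<open>e k = e l\<close> e(2) by metis
  qed
  have inj_e: "inj_on e {i..<j}" by (rule linorder_inj_onI) (use e_less in auto)
  have "is_cycle G (map v [i..<j]) (map e [i..<j])"
    unfolding is_cycle_def
  proof (intro conjI allI impI)
    fix k assume k: "k < length (map e [i..<j])"
    show "mends G (map e [i..<j] ! k) =
        {map v [i..<j] ! k, map v [i..<j] ! (Suc k mod length (map e [i..<j]))}"
    proof (cases "Suc (i + k) = j")
      case True
      then have "Suc k = j - i" using k by simp
      then show ?thesis using k e(3)[of "i + k"] i True by simp
    next
      case False
      then show ?thesis using k e(3)[of "i + k"] by simp
    qed
  qed (use i inj_v inj_e e(1) v S(2) in \<open>auto simp: distinct_map\<close>)
  then show False using G unfolding no_cycles_def by blast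
qed

text \<open>Each face equates the path \<open>a\<close> \<open>b\<close> with the path
  \<open>c\<close> \<open>d\<close>. The condition \<open>leaf\<close> is the forest condition on
  the two sides leaving the initial corner, phrased for sets of faces so that no graph and no vertex
  has to be named; \<open>connected\<close> avoids topology in the same spirit. Since
  \<open>src\<close> and \<open>tgt\<close> are parameters, edges may be reversed in an
  instance.\<close>

locale square_complex =
  fixes V :: "'v set" and E :: "'e set" and F :: "'f set"
    and src tgt :: "'e \<Rightarrow> 'v" and a b c d :: "'f \<Rightarrow> 'e"
  assumes finite: "finite V" "finite E" "finite F"
    and ends: "\<And>e. e \<in> E \<Longrightarrow> src e \<in> V" "\<And>e. e \<in> E \<Longrightarrow> tgt e \<in> V"
    and bd: "\<And>f. f \<in> F \<Longrightarrow> a f \<in> E" "\<And>f. f \<in> F \<Longrightarrow> b f \<in> E"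
      "\<And>f. f \<in> F \<Longrightarrow> c f \<in> E" "\<And>f. f \<in> F \<Longrightarrow> d f \<in> E"
    and corners: "\<And>f. f \<in> F \<Longrightarrow> src (a f) = src (c f)" "\<And>f. f \<in> F \<Longrightarrow> tgt (a f) = src (b f)"
      "\<And>f. f \<in> F \<Longrightarrow> tgt (c f) = src (d f)" "\<And>f. f \<in> F \<Longrightarrow> tgt (b f) = tgt (d f)"
    and leaf: "\<And>F'. F' \<subseteq> F \<Longrightarrow> F' \<noteq> {} \<Longrightarrow>
      \<exists>f\<in>F'. \<exists>e\<in>{a f, c f}. a f \<noteq> c f \<and> (\<forall>f'\<in>F' - {f}. a f' \<noteq> e \<and> c f' \<noteq> e)"
    and connected: "\<And>W. W \<subseteq> V \<Longrightarrow> (\<And>e. e \<in> E \<Longrightarrow> src e \<in> W \<longleftrightarrow> tgt e \<in> W) \<Longrightarrow> W = {} \<or> W = V"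
begin

section \<open>The twisted chain complex of a square complex\<close>

definition X :: "int poly" where "X = [:0, 1:]"

text \<open>The Fox derivative of the word \<open>a b (c d)^-1\<close> when every edge is sent to
  \<open>X\<close>. At \<open>X = 0\<close> only the two sides leaving the initial corner
  survive.\<close>

definition bd_coeff :: "'f \<Rightarrow> 'e \<Rightarrow> int poly" where
  "bd_coeff f e =
     of_bool (a f = e) + X * of_bool (b f = e) - of_bool (c f = e) - X * of_bool (d f = e)"

definition cobd_coeff :: "'v \<Rightarrow> 'e \<Rightarrow> int poly" where
  "cobd_coeff v e = X * of_bool (tgt e = v) - of_bool (src e = v)"

text \<open>A leaf of the support of \<open>z\<close> is an edge met by a single face of the
  support, and with a single sign because \<open>a\<close> and \<open>c\<close> differ there; its
  coefficient cannot cancel.\<close>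

lemma bd_injective_at_0:
  fixes z :: "'f \<Rightarrow> int"
  assumes z: "\<And>e. e \<in> E \<Longrightarrow> (\<Sum>f\<in>F. z f * (of_bool (a f = e) - of_bool (c f = e))) = 0"
    and "f \<in> F"
  shows "z f = 0"
proof (rule ccontr)
  assume "z f \<noteq> 0"
  define F' where "F' = {f \<in> F. z f \<noteq> 0}"
  have F': "F' \<subseteq> F" "F' \<noteq> {}" using \<open>z f \<noteq> 0\<close> \<open>f \<in> F\<close> unfolding F'_def by auto
  from leaf[OF F'] obtain g e where g: "g \<in> F'" "e \<in> {a g, c g}" "a g \<noteq> c g"
    "\<forall>f'\<in>F' - {g}. a f' \<noteq> e \<and> c f' \<noteq> e" by blast
  have "e \<in> E" using g F' bd by auto
  have "(\<Sum>f\<in>F. z f * (of_bool (a f = e) - of_bool (c f = e))) =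
      z g * (of_bool (a g = e) - of_bool (c g = e))"
  proof (subst sum.mono_neutral_right[of F "{g}"])
    show "\<forall>i\<in>F - {g}. z i * (of_bool (a i = e) - of_bool (c i = e)) = 0"
      using g(4) unfolding F'_def by auto
  qed (use g F' finite in auto)
  then have "z g * (of_bool (a g = e) - of_bool (c g = e)) = 0" using z \<open>e \<in> E\<close> by simp
  then show False using g unfolding F'_def by auto
qed

text \<open>Descent on degrees: the constant terms of a kernel element form a kernel element at
  \<open>X = 0\<close> and vanish, and dividing by \<open>X\<close> gives a kernel element of
  smaller total degree.\<close>

lemma bd_injective:
  assumes "\<And>e. e \<in> E \<Longrightarrow> (\<Sum>f\<in>F. x f * bd_coeff f e) = 0" and "f \<in> F"
  shows "x f = 0"
  using assms
proof (induction "\<Sum>f\<in>F. degree (x f)" arbitrary: x f rule: less_induct)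
  case less
  have "poly (x f) 0 = 0" if "f \<in> F" for f
  proof (rule bd_injective_at_0[OF _ that])
    fix e assume "e \<in> E"
    have "(\<Sum>f\<in>F. poly (x f * bd_coeff f e) 0) = 0"
      using less.prems(1)[OF \<open>e \<in> E\<close>] by (metis poly_sum poly_0)
    moreover have "poly (bd_coeff f e) 0 = of_bool (a f = e) - of_bool (c f = e)" for f
      by (simp add: bd_coeff_def X_def of_bool_def)
    ultimately show "(\<Sum>f\<in>F. poly (x f) 0 * (of_bool (a f = e) - of_bool (c f = e))) = 0"
      by simp
  qed
  then have "\<exists>y. x f = X * y" if "f \<in> F" for f
    using that by (cases "x f") (fastforce simp: X_def)
  then obtain y where y: "\<And>f. f \<in> F \<Longrightarrow> x f = X * y f" by metis
  have y_zero: "(\<Sum>f\<in>F. y f * bd_coeff f e) = 0" if "e \<in> E" for e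
  proof -
    have "X * (\<Sum>f\<in>F. y f * bd_coeff f e) = 0"
      using less.prems(1)[OF that] y by (simp add: sum_distrib_left mult.assoc)
    then show ?thesis by (simp add: X_def)
  qed
  show ?case
  proof (rule ccontr)
    assume "x f \<noteq> 0"
    \<comment> \<open>The correction term is needed because the zero polynomial has degree 0, which
      multiplication by \<open>X\<close> does not raise.\<close>
    have deg: "degree (x g) = degree (y g) + of_bool (y g \<noteq> 0)" if "g \<in> F" for g
      using y[OF that] by (auto simp: X_def)
    have "y f \<noteq> 0" using \<open>x f \<noteq> 0\<close> y less.prems(2) by auto
    then have "(\<Sum>f\<in>F. degree (y f)) < (\<Sum>f\<in>F. degree (x f))"
      using deg less.prems(2) finite(3) by (intro sum_strict_mono_ex1) auto
    then show False
      using less.hyps[of y f] y_zero less.prems(2) \<open>y f \<noteq> 0\<close> by blast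
  qed
qed

text \<open>Each corner of a face is met by two sides with opposite signs and the same power of
  \<open>X\<close>, the exponent being its distance from the initial corner. This is the dual form
  of a boundary having no boundary.\<close>

lemma cobd_bd_orthogonal:
  assumes "f \<in> F"
  shows "(\<Sum>e\<in>E. cobd_coeff v e * bd_coeff f e) = 0"
proof -
  have pick: "(\<Sum>e\<in>E. cobd_coeff v e * of_bool (e' = e)) = cobd_coeff v e'" if "e' \<in> E" for e'
    using that finite(2) by (simp add: of_bool_def if_distrib cong: if_cong)
  have "(\<Sum>e\<in>E. cobd_coeff v e * bd_coeff f e) =
      (\<Sum>e\<in>E. cobd_coeff v e * of_bool (a f = e)) + X * (\<Sum>e\<in>E. cobd_coeff v e * of_bool (b f = e))
    - (\<Sum>e\<in>E. cobd_coeff v e * of_bool (c f = e)) - X * (\<Sum>e\<in>E. cobd_coeff v e * of_bool (d f = e))"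
    by (simp add: bd_coeff_def sum_distrib_left sum.distrib sum_subtractf algebra_simps)
  also have "\<dots> = 0"
    unfolding pick[OF bd(1)[OF assms]] pick[OF bd(2)[OF assms]] pick[OF bd(3)[OF assms]]
      pick[OF bd(4)[OF assms]] by (simp add: cobd_coeff_def corners assms algebra_simps)
  finally show ?thesis .
qed

text \<open>One linear system combines both maps: the equations are indexed by edges, the unknowns
  by vertices and faces. With too few equations there is a nonzero solution, and orthogonality
  together with \<open>bd_injective\<close> leaves only its vertex part.\<close>

lemma card_le_or_height:
  "card V + card F \<le> card E \<or> (\<exists>h :: 'v \<Rightarrow> int. \<forall>e\<in>E. h (tgt e) = h (src e) + 1)"
proof (cases "card V + card F \<le> card E")
  case False
  then have "card E < card (V <+> F)" using finite by (simp add: card_Plus)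
  then obtain x where x: "\<exists>j\<in>V <+> F. x j \<noteq> 0"
    "\<And>e. e \<in> E \<Longrightarrow> (\<Sum>j\<in>V <+> F. (case j of Inl v \<Rightarrow> cobd_coeff v e | Inr f \<Rightarrow> bd_coeff f e) * x j) = 0"
    using homogeneous_system_nontrivial_solution[of E "V <+> F"
        "\<lambda>e j. case j of Inl v \<Rightarrow> cobd_coeff v e | Inr f \<Rightarrow> bd_coeff f e"] finite by auto
  define \<phi> where "\<phi> v = x (Inl v)" for v
  define \<xi> where "\<xi> f = x (Inr f)" for f
  define p where "p e = (\<Sum>v\<in>V. \<phi> v * cobd_coeff v e)" for e
  define q where "q e = (\<Sum>f\<in>F. \<xi> f * bd_coeff f e)" for e
  have pq: "p e + q e = 0" if "e \<in> E" for e
    using x(2)[OF that] finite by (simp add: sum.Plus p_def q_def \<phi>_def \<xi>_def mult.commute)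
  have "(\<Sum>e\<in>E. p e * q e) = (\<Sum>e\<in>E. \<Sum>v\<in>V. \<Sum>f\<in>F. \<phi> v * \<xi> f * (cobd_coeff v e * bd_coeff f e))"
    by (simp add: p_def q_def sum_product algebra_simps)
  also have "\<dots> = (\<Sum>v\<in>V. \<Sum>f\<in>F. \<Sum>e\<in>E. \<phi> v * \<xi> f * (cobd_coeff v e * bd_coeff f e))"
    by (subst sum.swap, rule sum.cong[OF refl], subst sum.swap) (rule refl)
  also have "\<dots> = 0"
    by (simp add: sum_distrib_left[symmetric] cobd_bd_orthogonal)
  finally have "(\<Sum>e\<in>E. p e * q e) = 0" .
  moreover have "p e * q e = - (p e * p e)" if "e \<in> E" for e
    using pq[OF that] by (simp add: add_eq_0_iff)
  ultimately have "(\<Sum>e\<in>E. p e * p e) = 0" by (simp add: sum_negf)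
  \<comment> \<open>Squares in \<open>int poly\<close> are nonnegative for its order, so each term
    of the vanishing sum is zero, and the vertex part and the face part solve the system
    separately.\<close>
  then have p0: "p e = 0" if "e \<in> E" for e
    using that finite(2) sum_nonneg_eq_0_iff[of E "\<lambda>e. p e * p e"] by simp
  then have "\<xi> f = 0" if "f \<in> F" for f
    using that pq bd_injective[of \<xi>] unfolding q_def by simp
  then obtain v0 where v0: "v0 \<in> V" "\<phi> v0 \<noteq> 0" using x(1) unfolding \<phi>_def \<xi>_def by fastforce
  have rec: "\<phi> (src e) = X * \<phi> (tgt e)" if "e \<in> E" for e
  proof -
    have pick: "(\<Sum>v\<in>V. \<phi> v * of_bool (u = v)) = \<phi> u" if "u \<in> V" for u
      using that finite(1) by (simp add: of_bool_def if_distrib cong: if_cong)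
    have "p e = X * (\<Sum>v\<in>V. \<phi> v * of_bool (tgt e = v)) - (\<Sum>v\<in>V. \<phi> v * of_bool (src e = v))"
      by (simp add: p_def cobd_coeff_def sum_distrib_left sum_subtractf algebra_simps)
    then show ?thesis using p0[OF that] ends[OF that] by (simp add: pick)
  qed
  \<comment> \<open>Multiplication by \<open>X\<close> preserves being nonzero, so the support of
    \<open>\<phi>\<close> is closed under adjacency. Being nonzero everywhere matters, as
    \<open>degree\<close> says nothing useful about 0.\<close>
  have "{v \<in> V. \<phi> v \<noteq> 0} = V"
    using connected[of "{v \<in> V. \<phi> v \<noteq> 0}"] v0 rec ends by (auto simp: X_def)
  then have "\<forall>e\<in>E. - int (degree (\<phi> (tgt e))) = - int (degree (\<phi> (src e))) + 1"
    using rec ends(2) by (auto simp: X_def)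
  then have "\<exists>h :: 'v \<Rightarrow> int. \<forall>e\<in>E. h (tgt e) = h (src e) + 1"
    by (rule exI[of _ "\<lambda>v. - int (degree (\<phi> v))"])
  then show ?thesis by (rule disjI2)
qed simp

text \<open>The sides \<open>b\<close> and \<open>d\<close> start one level above the initial corner
  of their face, hence never at the minimal level \<open>m\<close>. An edge starting at level
  \<open>m\<close> can thus only be a side \<open>a\<close> or \<open>c\<close> of a lowest face,
  and there \<open>leaf\<close> isolates one.\<close>

lemma free_edge:
  assumes h: "\<forall>e\<in>E. h (tgt e) = h (src e) + (1::int)" and F': "F' \<subseteq> F" "F' \<noteq> {}"
  shows "\<exists>f\<in>F'. \<exists>e\<in>{a f, c f}. a f \<noteq> c f \<and> b f \<noteq> e \<and> d f \<noteq> e \<and>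
    (\<forall>f'\<in>F' - {f}. e \<notin> {a f', b f', c f', d f'})"
proof -
  define m where "m = Min ((\<lambda>f. h (src (a f))) ` F')"
  define M where "M = {f \<in> F'. h (src (a f)) = m}"
  have fin: "finite F'" using F' finite finite_subset by blast
  have m_le: "m \<le> h (src (a f))" if "f \<in> F'" for f using that fin by (simp add: m_def)
  have "m \<in> (\<lambda>f. h (src (a f))) ` F'" unfolding m_def using fin F' by (intro Min_in) auto
  then have "M \<subseteq> F" "M \<noteq> {}" using F' unfolding M_def by auto
  from leaf[OF this] obtain f e where f: "f \<in> M" "e \<in> {a f, c f}" "a f \<noteq> c f"
    "\<forall>f'\<in>M - {f}. a f' \<noteq> e \<and> c f' \<noteq> e" by blast
  have he: "h (src e) = m" using f corners(1) F' unfolding M_def by auto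
  have "b g \<noteq> e \<and> d g \<noteq> e" if "g \<in> F'" for g
  proof -
    have "g \<in> F" using that F' by auto
    then have "h (src (b g)) = h (src (a g)) + 1" "h (src (d g)) = h (src (a g)) + 1"
      using h bd corners by metis+
    then show ?thesis using m_le[OF that] he by auto
  qed
  moreover have "a g \<noteq> e \<and> c g \<noteq> e" if "g \<in> F' - {f}" for g
  proof (cases "g \<in> M")
    case False
    then show ?thesis using that he corners(1)[of g] F' unfolding M_def by auto
  qed (use f that in auto)
  ultimately have "a f \<noteq> c f \<and> b f \<noteq> e \<and> d f \<noteq> e \<and> (\<forall>f'\<in>F' - {f}. e \<notin> {a f', b f', c f', d f'})"
    using f M_def by fastforce
  then show ?thesis using f M_def by blast
qed

end

section \<open>Attaching cells and extending lifts\<close>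

text \<open>The straight-line homotopy from the identity of \<open>D\<close> to the retraction is
  stationary on \<open>B\<close>, so it descends along \<open>\<psi>\<close> and fits the constant
  homotopy on \<open>S\<close>. The statement covers both a disc attached along all but one side and
  an interval attached at one end.\<close>

lemma attach_along_retract:
  fixes D :: "'d::euclidean_space set" and \<psi> :: "'d \<Rightarrow> 'y"
  assumes Y: "Hausdorff_space Y" and S: "closedin Y S"
    and D: "compact D" "convex D" "B retract_of D"
    and \<psi>: "continuous_map (top_of_set D) Y \<psi>" "\<psi> ` B \<subseteq> S" "inj_on \<psi> (D - B)" "\<psi> ` (D - B) \<inter> S = {}"
  defines "X \<equiv> subtopology Y (S \<union> \<psi> ` D)"
  shows "\<exists>r. homotopic_with (\<lambda>x. True) X X r id \<and> retraction_maps X (subtopology Y S) r id"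
proof -
  obtain \<rho> where \<rho>: "retraction D B \<rho>" using D(3) unfolding retract_of_def by blast
  then have BD: "B \<subseteq> D" and cont_\<rho>: "continuous_on D \<rho>" and \<rho>_in: "\<And>z. z \<in> D \<Longrightarrow> \<rho> z \<in> B"
    and \<rho>_id: "\<And>z. z \<in> B \<Longrightarrow> \<rho> z = z" unfolding retraction_def by auto
  have S_top: "S \<subseteq> topspace Y" using S closedin_subset by blast
  have \<psi>D_top: "\<psi> ` D \<subseteq> topspace Y" using \<psi>(1) continuous_map_image_subset_topspace by fastforce
  have topX: "topspace X = S \<union> \<psi> ` D" using S_top \<psi>D_top unfolding X_def by auto
  have "compactin Y (\<psi> ` D)"
    using image_compactin[OF _ \<psi>(1), of D] D(1) by (simp add: compactin_subtopology)
  then have \<psi>D_closed: "closedin Y (\<psi> ` D)" using Y compactin_imp_closedin by blast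
  have \<psi>X: "continuous_map (top_of_set D) X \<psi>"
    unfolding X_def using \<psi>(1) by (auto intro!: continuous_map_into_subtopology)
  define h where "h p = (1 - fst p) *\<^sub>R snd p + fst p *\<^sub>R \<rho> (snd p)" for p :: "real \<times> 'd"
  \<comment> \<open>\<open>inv_into\<close> is evaluated only off \<open>S\<close>, where a point of
    the image has exactly one preimage in \<open>D\<close>.\<close>
  define H where "H p = (if snd p \<in> S then snd p else \<psi> (h (fst p, inv_into D \<psi> (snd p))))" for p
  have h_in: "h p \<in> D" if "p \<in> {0..1} \<times> D" for p
    using that \<rho>_in BD D(2) unfolding h_def by (intro convexD) auto
  have cont_h: "continuous_on ({0..1} \<times> D) h"
    unfolding h_def by (intro continuous_intros continuous_on_compose2[OF cont_\<rho>]) auto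
  have H_\<psi>: "H (t, \<psi> z) = \<psi> (h (t, z))" if "z \<in> D" for t z
  proof (cases "z \<in> B")
    case True
    then have "h (t, z) = z" by (simp add: h_def \<rho>_id algebra_simps)
    then show ?thesis using True \<psi>(2) by (auto simp: H_def)
  next
    case False
    then have "\<psi> z \<notin> S" using that \<psi>(4) by auto
    moreover have "inv_into D \<psi> (\<psi> z) = z"
    proof -
      define z' where "z' = inv_into D \<psi> (\<psi> z)"
      have z': "z' \<in> D" "\<psi> z' = \<psi> z"
        unfolding z'_def using that by (auto intro: inv_into_into f_inv_into_f)
      then have "z' \<notin> B" using \<psi>(2) \<open>\<psi> z \<notin> S\<close> by auto
      then show ?thesis using inj_onD[OF \<psi>(3) z'(2)] z' that False unfolding z'_def by auto
    qed
    ultimately show ?thesis by (simp add: H_def)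
  qed
  let ?I = "top_of_set {0..1::real}"
  have contH: "continuous_map (prod_topology ?I X) X H"
  proof (rule pasting_lemma_closed[where I = UNIV and f = "\<lambda>_. H"
        and T = "\<lambda>b. {0..1} \<times> (if b then S else \<psi> ` D)"])
    fix b :: bool
    have "closedin X S" "closedin X (\<psi> ` D)"
      unfolding X_def by (auto intro!: closedin_subset_topspace S \<psi>D_closed)
    then show "closedin (prod_topology ?I X) ({0..1} \<times> (if b then S else \<psi> ` D))"
      by (simp add: closedin_prod_Times_iff)
    show "continuous_map (subtopology (prod_topology ?I X) ({0..1} \<times> (if b then S else \<psi> ` D))) X H"
    proof (cases b)
      case True
      have "continuous_map (subtopology (prod_topology ?I X) ({0..1} \<times> S)) X snd"
        by (intro continuous_map_from_subtopology continuous_map_snd)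
      then show ?thesis using True by (auto intro: continuous_map_eq simp: H_def)
    next
      case False
      let ?Z = "subtopology Y (\<psi> ` D)"
      have Z: "subtopology X (\<psi> ` D) = ?Z"
        unfolding X_def by (simp add: subtopology_subtopology Int_absorb1)
      have "continuous_map (top_of_set D) ?Z \<psi>"
        using \<psi>(1) by (auto intro!: continuous_map_into_subtopology)
      then have "continuous_map (prod_topology ?I (top_of_set D)) (prod_topology ?I ?Z) (\<lambda>(t, z). (t, \<psi> z))"
        unfolding case_prod_unfold
        by (intro continuous_map_pairedI continuous_map_fst
            continuous_map_compose[OF continuous_map_snd, unfolded comp_def])
      \<comment> \<open>\<open>\<psi>\<close> may identify points of \<open>B\<close>, so continuity
        is tested after composing with the product of the identity and \<open>\<psi>\<close>, a
        quotient map because it goes from a compact space onto a Hausdorff space.\<close>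
      then have q: "quotient_map (prod_topology ?I (top_of_set D)) (prod_topology ?I ?Z) (\<lambda>(t, z). (t, \<psi> z))"
      proof (rule continuous_imp_quotient_map)
        show "compact_space (prod_topology ?I (top_of_set D))"
          by (auto intro!: compact_space_subtopology compact_Times D(1))
        show "Hausdorff_space (prod_topology ?I ?Z)"
          by (simp add: Hausdorff_space_prod_topology Hausdorff_space_subtopology Y)
        show "(\<lambda>(t, z). (t, \<psi> z)) ` topspace (prod_topology ?I (top_of_set D)) = topspace (prod_topology ?I ?Z)"
          using \<psi>D_top by (auto simp: image_iff)
      qed
      have "continuous_map (prod_topology ?I (top_of_set D)) (top_of_set D) h"
        using cont_h h_in by (auto simp flip: subtopology_Times simp: continuous_map_in_subtopology)
      then have "continuous_map (prod_topology ?I (top_of_set D)) X (\<psi> \<circ> h)"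
        using \<psi>X continuous_map_compose by blast
      then have "continuous_map (prod_topology ?I (top_of_set D)) X (H \<circ> (\<lambda>(t, z). (t, \<psi> z)))"
        by (rule continuous_map_eq) (auto simp: H_\<psi>)
      then have "continuous_map (prod_topology ?I ?Z) X H"
        by (rule continuous_compose_quotient_map[OF q])
      then show ?thesis using False by (simp add: subtopology_Times subtopology_subtopology Z)
    qed
  qed (auto simp: topX)
  define r where "r x = H (1, x)" for x
  have H0: "H (0, x) = x" if x: "x \<in> topspace X" for x
  proof (cases "x \<in> S")
    case False
    then obtain z where "z \<in> D" "x = \<psi> z" using x topX by auto
    then show ?thesis using H_\<psi>[of z 0] by (simp add: h_def)
  qed (simp add: H_def)
  have rS: "r x \<in> S" if x: "x \<in> topspace X" for x
  proof (cases "x \<in> S")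
    case False
    then obtain z where "z \<in> D" "x = \<psi> z" using x topX by auto
    then show ?thesis using H_\<psi>[of z 1] \<rho>_in \<psi>(2) unfolding r_def h_def by auto
  qed (simp add: H_def r_def)
  have contr: "continuous_map X X r"
  proof -
    have "continuous_map X (prod_topology ?I X) (\<lambda>x. (1, x))"
      by (auto intro!: continuous_map_pairedI)
    from continuous_map_compose[OF this contH] show ?thesis
      unfolding r_def comp_def .
  qed
  have "homotopic_with (\<lambda>x. True) X X id r"
    unfolding homotopic_with_def
  proof (intro exI conjI)
    \<comment> \<open>\<open>homotopic_with\<close> prescribes the ends at all points of the type,
      whereas \<open>H (0, x) = x\<close> holds only on the space; hence the case
      distinction.\<close>
    show "continuous_map (prod_topology ?I X) X (\<lambda>p. if fst p = 0 then snd p else H p)"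
      by (rule continuous_map_eq[OF contH]) (auto simp: H0)
    show "\<forall>x. (if fst (0, x) = (0::real) then snd (0, x) else H (0, x)) = id x" by simp
    show "\<forall>x. (if fst (1, x) = (0::real) then snd (1, x) else H (1, x)) = r x" by (simp add: r_def)
  qed simp
  moreover have "retraction_maps X (subtopology Y S) r id"
    unfolding retraction_maps_def
  proof (intro conjI ballI)
    show "continuous_map X (subtopology Y S) r"
      using contr rS unfolding X_def by (auto simp: continuous_map_in_subtopology)
    show "continuous_map (subtopology Y S) X id"
      unfolding X_def by (auto simp: continuous_map_in_subtopology intro: continuous_map_from_subtopology)
    show "r (id x) = x" if "x \<in> topspace (subtopology Y S)" for x
      using that by (simp add: r_def H_def)
  qed
  ultimately show ?thesis using homotopic_with_sym by blast
qed

text \<open>Near a boundary point \<open>z\<close>, compactness of \<open>Y\<close> keeps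
  \<open>s\<close> close to the finite fibre over \<open>q z\<close>, and a ball cut with the convex
  interior is connected, which keeps \<open>s\<close> close to a single point of that fibre. So
  \<open>s\<close> has a limit at every boundary point, and regularity of \<open>Y\<close> makes the
  pointwise extension continuous.\<close>

lemma extension_of_lift_to_closure:
  fixes D :: "'d::euclidean_space set" and f :: "'y \<Rightarrow> 'x"
  assumes D: "closed D" "convex D" "interior D \<noteq> {}"
    and Y: "compact_space Y" "Hausdorff_space Y" and X: "Hausdorff_space X"
    and f: "continuous_map Y X f" "\<And>x. finite {y \<in> topspace Y. f y = x}"
    and q: "continuous_map (top_of_set D) X q"
    and s: "continuous_map (top_of_set (interior D)) Y s" "\<And>w. w \<in> interior D \<Longrightarrow> f (s w) = q w"
  obtains \<psi> where "continuous_map (top_of_set D) Y \<psi>" "\<And>z. z \<in> D \<Longrightarrow> f (\<psi> z) = q z"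
    "\<And>w. w \<in> interior D \<Longrightarrow> \<psi> w = s w"
proof -
  let ?D = "interior D"
  have dense: "D = closure ?D" using D convex_closure_interior by force
  have s_top: "s w \<in> topspace Y" if "w \<in> ?D" for w
    using s(1) that continuous_map_image_subset_topspace by fastforce
  \<comment> \<open>The complement of \<open>W\<close> is compact, so its image is closed; this
    image misses \<open>q z\<close> and hence a whole neighbourhood of \<open>z\<close>.\<close>
  have near: "\<exists>r>0. s ` (ball z r \<inter> ?D) \<subseteq> W"
    if z: "z \<in> D" and W: "openin Y W" "{y \<in> topspace Y. f y = q z} \<subseteq> W" for z W
  proof -
    have "closedin Y (topspace Y - W)" using W(1) by blast
    then have "compactin Y (topspace Y - W)" using Y(1) closedin_compact_space by blast
    then have "closedin X (f ` (topspace Y - W))"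
      using image_compactin[OF _ f(1)] X compactin_imp_closedin by blast
    then have "closedin (top_of_set D) {w \<in> D. q w \<in> f ` (topspace Y - W)}"
      using closedin_continuous_map_preimage[OF q] by simp
    then have "closed {w \<in> D. q w \<in> f ` (topspace Y - W)}" using D(1) closedin_closed_trans by blast
    moreover have "z \<notin> {w \<in> D. q w \<in> f ` (topspace Y - W)}" using W(2) by auto
    ultimately obtain r where r: "r > 0" "ball z r \<inter> {w \<in> D. q w \<in> f ` (topspace Y - W)} = {}"
      by (metis (no_types, lifting) ComplI Compl_disjoint Int_commute disjoint_eq_subset_Compl open_Compl openE)
    have "s w \<in> W" if "w \<in> ball z r \<inter> ?D" for w
    proof (rule ccontr)
      assume "s w \<notin> W"
      then have "q w \<in> f ` (topspace Y - W)" using that s_top s(2)[of w] by (metis Diff_iff IntD2 imageI)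
      then show False using r(2) that interior_subset by blast
    qed
    then show ?thesis using r(1) by blast
  qed
  have meet: "ball z r \<inter> ?D \<noteq> {}" if "z \<in> D" "r > 0" for z r
  proof -
    have "z \<in> ball z r \<inter> closure ?D" using that dense by auto
    then show ?thesis using open_Int_closure_eq_empty[of "ball z r" ?D] by blast
  qed
  have lim: "\<exists>l. limitin Y s l (atin_within euclidean z ?D)" if z: "z \<in> D" for z
  proof -
    define \<Phi> where "\<Phi> = {y \<in> topspace Y. f y = q z}"
    have fin: "finite \<Phi>" unfolding \<Phi>_def by (rule f(2))
    have "\<exists>P Q. openin Y P \<and> openin Y Q \<and> y \<in> P \<and> \<Phi> - {y} \<subseteq> Q \<and> disjnt P Q" if "y \<in> \<Phi>" for y
    proof -
      have "compactin Y {y}" "compactin Y (\<Phi> - {y})"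
        using that fin by (auto simp: \<Phi>_def intro!: finite_imp_compactin)
      moreover have "disjnt {y} (\<Phi> - {y})" by (simp add: disjnt_def)
      ultimately show ?thesis using Hausdorff_space_compact_separation[OF Y(2)] by (metis insert_subset)
    qed
    then obtain P Q where PQ: "\<And>y. y \<in> \<Phi> \<Longrightarrow> openin Y (P y)" "\<And>y. y \<in> \<Phi> \<Longrightarrow> openin Y (Q y)"
      "\<And>y. y \<in> \<Phi> \<Longrightarrow> y \<in> P y" "\<And>y. y \<in> \<Phi> \<Longrightarrow> \<Phi> - {y} \<subseteq> Q y" "\<And>y. y \<in> \<Phi> \<Longrightarrow> disjnt (P y) (Q y)"
      by metis
    have "\<exists>r>0. s ` (ball z r \<inter> ?D) \<subseteq> P y \<union> Q y" if "y \<in> \<Phi>" for y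
      using PQ[OF that] by (intro near z openin_Un) (auto simp flip: \<Phi>_def)
    then obtain r where r: "\<And>y. y \<in> \<Phi> \<Longrightarrow> r y > 0" "\<And>y. y \<in> \<Phi> \<Longrightarrow> s ` (ball z (r y) \<inter> ?D) \<subseteq> P y \<union> Q y"
      by metis
    have dichotomy: "s ` (ball z (r y) \<inter> ?D) \<subseteq> P y \<or> s ` (ball z (r y) \<inter> ?D) \<subseteq> Q y" if "y \<in> \<Phi>" for y
    proof -
      have "connectedin (top_of_set ?D) (ball z (r y) \<inter> ?D)"
        using D(2) by (auto simp: connectedin_subtopology intro!: convex_connected convex_Int)
      then have "connectedin Y (s ` (ball z (r y) \<inter> ?D))"
        using s(1) connectedin_continuous_map_image by blast
      moreover have "P y \<inter> Q y \<inter> s ` (ball z (r y) \<inter> ?D) = {}"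
        using PQ(5)[OF that] by (auto simp: disjnt_def)
      ultimately have "P y \<inter> s ` (ball z (r y) \<inter> ?D) = {} \<or> Q y \<inter> s ` (ball z (r y) \<inter> ?D) = {}"
        using connectedinD[OF _ PQ(1)[OF that] PQ(2)[OF that] r(2)[OF that]] by blast
      then show ?thesis using r(2)[OF that] by blast
    qed
    \<comment> \<open>The alternative would place points close to \<open>z\<close> in every
      \<open>Q y\<close>, yet the union of the \<open>P y\<close> is a neighbourhood of the fibre
      and must contain such points.\<close>
    have "\<exists>y\<in>\<Phi>. s ` (ball z (r y) \<inter> ?D) \<subseteq> P y"
    proof (rule ccontr)
      assume "\<not> ?thesis"
      then have allQ: "\<And>y. y \<in> \<Phi> \<Longrightarrow> s ` (ball z (r y) \<inter> ?D) \<subseteq> Q y" using dichotomy by blast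
      have "\<exists>r'>0. s ` (ball z r' \<inter> ?D) \<subseteq> \<Union>(P ` \<Phi>)"
        using PQ by (intro near z) (auto simp flip: \<Phi>_def)
      then obtain r' where r': "r' > 0" "s ` (ball z r' \<inter> ?D) \<subseteq> \<Union>(P ` \<Phi>)" by blast
      define m where "m = Min (insert r' (r ` \<Phi>))"
      have "m > 0" "m \<le> r'" "\<And>y. y \<in> \<Phi> \<Longrightarrow> m \<le> r y" using r(1) r'(1) fin by (auto simp: m_def)
      moreover obtain w where "w \<in> ball z m \<inter> ?D" using meet[OF z \<open>m > 0\<close>] by blast
      ultimately have "s w \<in> \<Union>(P ` \<Phi>)" "\<And>y. y \<in> \<Phi> \<Longrightarrow> s w \<in> Q y"
        using r'(2) allQ by (fastforce simp: image_subset_iff)+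
      then show False using PQ(5) by (auto simp: disjnt_def)
    qed
    then obtain y where y: "y \<in> \<Phi>" "s ` (ball z (r y) \<inter> ?D) \<subseteq> P y" by blast
    have "limitin Y s y (atin_within euclidean z ?D)"
      unfolding limitin_def
    proof (intro conjI allI impI)
      show "y \<in> topspace Y" using y(1) by (simp add: \<Phi>_def)
      fix U assume U: "openin Y U \<and> y \<in> U"
      have "\<exists>r'>0. s ` (ball z r' \<inter> ?D) \<subseteq> U \<union> Q y"
        using PQ(2,4)[OF y(1)] U by (intro near z openin_Un) (auto simp flip: \<Phi>_def)
      then obtain r' where r': "r' > 0" "s ` (ball z r' \<inter> ?D) \<subseteq> U \<union> Q y" by blast
      have "s w \<in> U" if "w \<in> ball z (min r' (r y)) \<inter> ?D" for w
      proof -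
        have "s w \<in> P y" "s w \<in> U \<union> Q y" using that r'(2) y(2) by (auto simp: image_subset_iff)
        then show ?thesis using PQ(5)[OF y(1)] by (auto simp: disjnt_def)
      qed
      then show "\<forall>\<^sub>F x in atin_within euclidean z ?D. s x \<in> U"
        unfolding eventually_atin_within using r(1)[OF y(1)] r'(1)
        by (intro disjI2 exI[of _ "ball z (min r' (r y))"]) auto
    qed
    then show ?thesis by blast
  qed
  obtain \<psi> where \<psi>: "continuous_map (top_of_set D) Y \<psi>" "\<And>w. w \<in> ?D \<Longrightarrow> \<psi> w = s w"
  proof (rule continuous_map_extension_pointwise_alt[of Y ?D D euclidean s])
    show "regular_space Y" using Y compact_Hausdorff_imp_regular_space by blast
    show "?D \<subseteq> D" by (rule interior_subset)
    show "D \<subseteq> euclidean closure_of ?D" using dense by simp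
    show "continuous_map (top_of_set ?D) Y s" by (rule s(1))
    show "\<exists>l. limitin Y s l (atin_within euclidean t ?D)" if "t \<in> D - ?D" for t
      using that lim by blast
  qed blast
  moreover have "f (\<psi> z) = q z" if "z \<in> D" for z
  proof (rule forall_in_closure_of_eq[where S = ?D, OF _ X _ q])
    show "z \<in> top_of_set D closure_of ?D"
      using that dense interior_subset[of D] by (simp add: closure_of_subtopology Int_absorb1 inf.absorb2)
    show "continuous_map (top_of_set D) X (\<lambda>z. f (\<psi> z))"
      using continuous_map_compose[OF \<psi>(1) f(1)] by (simp add: comp_def)
    show "f (\<psi> w) = q w" if "w \<in> ?D" for w using that \<psi>(2) s(2) by simp
  qed
  ultimately show ?thesis using that by blast
qed

text \<open>A fibre is closed in a compact space, and local injectivity rules out accumulation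
  points in it: it is compact and discrete.\<close>

lemma finite_fibers_of_locally_injective:
  assumes Y: "compact_space Y" and X: "Hausdorff_space X" and f: "continuous_map Y X f"
    and inj: "\<And>y. y \<in> topspace Y \<Longrightarrow> \<exists>U. openin Y U \<and> y \<in> U \<and> inj_on f U"
  shows "finite {y \<in> topspace Y. f y = x}"
proof (cases "x \<in> topspace X")
  case True
  let ?F = "{y \<in> topspace Y. f y = x}"
  have "closedin X {x}" using X True by (simp add: closedin_Hausdorff_singleton)
  then have "closedin Y {y \<in> topspace Y. f y \<in> {x}}"
    using closedin_continuous_map_preimage[OF f] by blast
  then have "compactin Y ?F" using Y closedin_compact_space by simp
  moreover have "?F \<inter> Y derived_set_of ?F = {}"
  proof -
    have False if "y \<in> ?F" and lim: "y \<in> Y derived_set_of ?F" for y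
    proof -
      obtain U where U: "openin Y U" "y \<in> U" "inj_on f U" using inj \<open>y \<in> ?F\<close> by blast
      then obtain y' where "y' \<noteq> y" "y' \<in> ?F" "y' \<in> U"
        using lim unfolding in_derived_set_of by blast
      then show False using U \<open>y \<in> ?F\<close> unfolding inj_on_def by blast
    qed
    then show ?thesis by blast
  qed
  ultimately show ?thesis using discrete_compactin_eq_finite by blast
next
  case False
  then have "{y \<in> topspace Y. f y = x} = {}"
    using f continuous_map_image_subset_topspace by fastforce
  then show ?thesis by (metis finite.emptyI)
qed

section \<open>The standard complex is Hausdorff\<close>

text \<open>The parameter \<open>x\<close> is not confined to the unit interval: from 1 to
  \<open>n\<close> it runs through all sides other than side \<open>k\<close>.\<close>

definition side_point :: "nat \<Rightarrow> nat \<Rightarrow> real \<Rightarrow> complex" where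
  "side_point n k x = cis (2 * pi * (real k + x) / real n)"

lemma norm_side_point [simp]: "norm (side_point n k x) = 1"
  by (simp add: side_point_def)

lemma continuous_on_side_point: "continuous_on A (side_point n k)"
  unfolding side_point_def by (cases "n = 0") (auto intro!: continuous_intros)

lemma Arg2pi_cis:
  assumes "0 \<le> t" "t < 2 * pi"
  shows "Arg2pi (cis t) = t"
  using assms Arg2pi_unique[of 1 t "cis t"] by (simp add: cis_conv_exp)

lemma cis_Arg2pi: "norm z = 1 \<Longrightarrow> cis (Arg2pi z) = z"
  using Arg2pi_eq[of z] by (simp add: cis_conv_exp)

lemma sphere_point_on_side:
  assumes "norm z = 1" "n > 0"
  obtains k x where "k < n" "0 \<le> x" "x < 1" "z = side_point n k x"
proof -
  define y where "y = Arg2pi z * n / (2 * pi)"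
  have y: "0 \<le> y" "y < n" using Arg2pi_ge_0[of z] Arg2pi_lt_2pi[of z] assms(2)
    by (simp_all add: y_def field_simps)
  define k where "k = nat \<lfloor>y\<rfloor>"
  have k: "real k = \<lfloor>y\<rfloor>" using y by (simp add: k_def)
  have "z = side_point n k (frac y)"
    using cis_Arg2pi[OF assms(1)] assms(2) by (simp add: side_point_def k frac_def y_def)
  moreover have "k < n" using y k by linarith
  ultimately show ?thesis using that frac_ge_0 frac_lt_1 by blast
qed

lemma Arg2pi_side_point:
  assumes "k < n" "0 \<le> x" "x < 1"
  shows "Arg2pi (side_point n k x) = 2 * pi * (real k + x) / real n"
proof -
  have "(real k + x) / real n < 1" using assms by simp
  then have "2 * pi * ((real k + x) / real n) < 2 * pi * 1" by (intro mult_strict_left_mono) auto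
  then show ?thesis unfolding side_point_def using assms by (intro Arg2pi_cis) auto
qed

lemma side_point_1: "k < n \<Longrightarrow> side_point n k 1 = side_point n (Suc k mod n) 0"
proof (cases "Suc k = n")
  case True
  then have "real k + 1 = real n" "real n \<noteq> 0" by linarith+
  then have "2 * pi * (real k + 1) / real n = 2 * pi" by simp
  then show ?thesis using True by (simp add: side_point_def)
next
  case False
  moreover assume "k < n"
  ultimately show ?thesis by (simp add: side_point_def add.commute)
qed

definition letter_map :: "'g \<times> bool \<Rightarrow> real \<Rightarrow> 'g std_point" where
  "letter_map l x = edge_map (fst l) (if snd l then x else 1 - x)"

lemma face_map_side_point:
  assumes "k < length w" "0 \<le> x" "x \<le> 1"
  shows "face_map w (side_point (length w) k x) = letter_map (w ! k) x"
proof -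
  let ?n = "length w"
  have *: "face_map w (side_point ?n k x) = letter_map (w ! k) x"
    if "k < ?n" "0 \<le> x" "x < 1" for k x
  proof -
    have "Arg2pi (side_point ?n k x) = 2 * pi * (k + x) / ?n"
      using that by (rule Arg2pi_side_point)
    moreover have "\<lfloor>real k + x\<rfloor> = int k" using that by (simp add: floor_unique)
    ultimately show ?thesis
      using that by (auto simp: face_map_def word_loop_def letter_map_def frac_def Let_def split: prod.split)
  qed
  \<comment> \<open>\<open>word_loop\<close> reads the end of a letter as the start of the next one.
    The two readings agree because every letter starts and ends at \<open>Base\<close>.\<close>
  have base: "letter_map l 0 = Base" "letter_map l 1 = Base" for l :: "'a \<times> bool"
    by (auto simp: letter_map_def edge_map_def)
  show ?thesis
  proof (cases "x = 1")
    case True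
    have "0 < ?n" using assms(1) by linarith
    then have "face_map w (side_point ?n k 1) = letter_map (w ! (Suc k mod ?n)) 0"
      using *[of "Suc k mod ?n" 0] side_point_1[OF assms(1)] by simp
    then show ?thesis using True base by simp
  qed (use * assms in auto)
qed

text \<open>Empty words are left out so that every boundary point of a face lies on some
  side.\<close>

definition words_over :: "'g set \<Rightarrow> 'g word set" where
  "words_over A = {w. w \<noteq> [] \<and> fst ` set w \<subseteq> A}"

lemma edge_map_in_cells: "g \<in> gens P \<Longrightarrow> edge_map g x \<in> (\<Union>n. \<Union>(std_cells P n))"
proof (cases "0 < x \<and> x < 1")
  case True
  moreover assume "g \<in> gens P"
  ultimately have "edge_map g x \<in> \<Union>(std_cells P 1)" by (force simp: edge_map_def std_cells_def)
  then show ?thesis by blast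
next
  case False
  then have "edge_map g x \<in> \<Union>(std_cells P 0)" by (auto simp: edge_map_def std_cells_def)
  then show ?thesis by blast
qed

lemma face_map_in_cells:
  assumes "rels P \<subseteq> words_over (gens P)" "r \<in> rels P" "z \<in> cball 0 1"
  shows "face_map r z \<in> (\<Union>n. \<Union>(std_cells P n))"
proof (cases "norm z < 1")
  case True
  then have "face_map r z \<in> \<Union>(std_cells P 2)" using assms(2) by (force simp: face_map_def std_cells_def)
  then show ?thesis by blast
next
  case False
  have r: "r \<noteq> []" "fst ` set r \<subseteq> gens P" using assms by (auto simp: words_over_def)
  have "norm z = 1" using False assms(3) by simp
  then obtain k x where k: "k < length r" "0 \<le> x" "x < 1" "z = side_point (length r) k x"
    using sphere_point_on_side[of z "length r"] r(1) by blast
  then have "face_map r z = letter_map (r ! k) x" using face_map_side_point[of k r x] by simp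
  moreover have "fst (r ! k) \<in> gens P" using r(2) k(1) by (force simp: set_conv_nth)
  ultimately show ?thesis unfolding letter_map_def using edge_map_in_cells by metis
qed

section \<open>The coinduced topology of the standard complex\<close>

context
  fixes P :: "'g presentation"
  assumes P: "rels P \<subseteq> words_over (gens P)"
begin

abbreviation "XP \<equiv> cspace (standard_complex P)"

lemma topspace_standard_complex: "topspace XP = (\<Union>n. \<Union>(std_cells P n))"
proof
  show "topspace XP \<subseteq> (\<Union>n. \<Union>(std_cells P n))"
    unfolding topspace_def openin_standard_complex std_open_def by blast
  have all: "{x \<in> A. k x \<in> C} = A" if "\<And>x. x \<in> A \<Longrightarrow> k x \<in> C" for A :: "'b set" and k and C :: "'c set"
    using that by blast
  have "std_open P (\<Union>n. \<Union>(std_cells P n))"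
    unfolding std_open_def
  proof (intro conjI ballI subset_refl)
    fix g assume "g \<in> gens P"
    then have "{x \<in> {0..1}. edge_map g x \<in> (\<Union>n. \<Union>(std_cells P n))} = {0..1}"
      using edge_map_in_cells by (intro all)
    then show "openin (top_of_set {0..1}) {x \<in> {0..1}. edge_map g x \<in> (\<Union>n. \<Union>(std_cells P n))}" by simp
  next
    fix r assume "r \<in> rels P"
    then have "{z \<in> cball 0 1. face_map r z \<in> (\<Union>n. \<Union>(std_cells P n))} = cball 0 1"
      using face_map_in_cells[OF P] by (intro all)
    then show "openin (top_of_set (cball 0 1)) {z \<in> cball 0 1. face_map r z \<in> (\<Union>n. \<Union>(std_cells P n))}" by simp
  qed
  then show "(\<Union>n. \<Union>(std_cells P n)) \<subseteq> topspace XP"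
    unfolding topspace_def openin_standard_complex by blast
qed

lemma edge_map_in_topspace: "g \<in> gens P \<Longrightarrow> edge_map g x \<in> topspace XP"
  unfolding topspace_standard_complex by (rule edge_map_in_cells)

lemma face_map_in_topspace: "r \<in> rels P \<Longrightarrow> z \<in> cball 0 1 \<Longrightarrow> face_map r z \<in> topspace XP"
  unfolding topspace_standard_complex by (rule face_map_in_cells[OF P])

lemma continuous_map_edge_map: "g \<in> gens P \<Longrightarrow> continuous_map (top_of_set {0..1}) XP (edge_map g)"
  unfolding continuous_map openin_standard_complex
  by (simp add: std_open_def image_subset_iff edge_map_in_topspace)

lemma continuous_map_face_map: "r \<in> rels P \<Longrightarrow> continuous_map (top_of_set (cball 0 1)) XP (face_map r)"
  unfolding continuous_map openin_standard_complex
  using face_map_in_topspace by (simp add: std_open_def image_subset_iff)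

text \<open>The universal property of the coinduced topology; it produces the real and complex
  coordinates used to separate points.\<close>

lemma continuous_map_from_standard_complex:
  fixes h :: "'g std_point \<Rightarrow> 'z::topological_space"
  assumes "\<And>g. g \<in> gens P \<Longrightarrow> continuous_on {0..1} (\<lambda>x. h (edge_map g x))"
    and "\<And>r. r \<in> rels P \<Longrightarrow> continuous_on (cball 0 1) (\<lambda>z. h (face_map r z))"
  shows "continuous_map XP euclidean h"
  unfolding continuous_map openin_standard_complex
proof (intro conjI allI impI)
  fix U :: "'z set" assume "openin euclidean U"
  then have U: "open U" by simp
  have "openin (top_of_set A) {x \<in> A. k x \<in> topspace XP \<and> h (k x) \<in> U}"
    if "continuous_on A (\<lambda>x. h (k x))" "\<And>x. x \<in> A \<Longrightarrow> k x \<in> topspace XP"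
    for A :: "'b::topological_space set" and k
  proof -
    have "{x \<in> A. k x \<in> topspace XP \<and> h (k x) \<in> U} = A \<inter> (\<lambda>x. h (k x)) -` U" using that(2) by auto
    then show ?thesis using that(1) U by (simp add: continuous_openin_preimage_gen)
  qed
  note open_preimage = this
  show "std_open P {x \<in> topspace XP. h x \<in> U}"
    unfolding std_open_def
  proof (intro conjI ballI)
    show "{x \<in> topspace XP. h x \<in> U} \<subseteq> (\<Union>n. \<Union>(std_cells P n))"
      using topspace_standard_complex by blast
    fix g assume "g \<in> gens P"
    then show "openin (top_of_set {0..1}) {x \<in> {0..1}. edge_map g x \<in> {x \<in> topspace XP. h x \<in> U}}"
      using open_preimage[OF assms(1), of g] by (simp add: edge_map_in_topspace)
  next
    fix r assume "r \<in> rels P"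
    then show "openin (top_of_set (cball 0 1)) {z \<in> cball 0 1. face_map r z \<in> {x \<in> topspace XP. h x \<in> U}}"
      using open_preimage[OF assms(2), of r] face_map_in_topspace[of r]
      by (simp add: face_map_in_topspace cong: conj_cong)
  qed
qed simp

end

text \<open>Coordinates that separate the points of the standard complex: an edge is wound once around a
  circle through \<open>0\<close>, and this is cut off radially inside the faces.\<close>

definition loop_coord :: "'g \<Rightarrow> 'g std_point \<Rightarrow> complex" where
  "loop_coord g p = (case p of On_edge g' x \<Rightarrow> if g' = g then 1 - cis (2 * pi * x) else 0 | _ \<Rightarrow> 0)"

definition edge_coord :: "'g \<Rightarrow> 'g std_point \<Rightarrow> complex" where
  "edge_coord g p = (case p of
       On_face w z \<Rightarrow> of_real (max 0 (2 * norm z - 1)) * loop_coord g (word_loop w (Arg2pi z / (2 * pi)))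
     | _ \<Rightarrow> loop_coord g p)"

text \<open>The factor \<open>1 - norm z\<close> makes the coordinate vanish on the boundary of the
  face; the first component recovers this factor, so that \<open>z\<close> can be read off from the
  second.\<close>

definition face_coord :: "'g word \<Rightarrow> 'g std_point \<Rightarrow> real \<times> complex" where
  "face_coord w p = (case p of On_face w' z \<Rightarrow> if w' = w then (1 - norm z, (1 - norm z) *\<^sub>R z) else 0 | _ \<Rightarrow> 0)"

lemma loop_coord_edge_map:
  "0 \<le> x \<Longrightarrow> x \<le> 1 \<Longrightarrow> loop_coord g (edge_map g' x) = (if g' = g then 1 - cis (2 * pi * x) else 0)"
  by (cases "x = 0 \<or> x = 1") (auto simp: loop_coord_def edge_map_def)

lemma edge_coord_edge_map: "edge_coord g (edge_map g' x) = loop_coord g (edge_map g' x)"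
  by (simp add: edge_coord_def edge_map_def)

lemma face_coord_edge_map [simp]: "face_coord w (edge_map g x) = 0"
  by (simp add: face_coord_def edge_map_def)

lemma word_loop_eq_edge_map: "w \<noteq> [] \<Longrightarrow> \<exists>g x. word_loop w s = edge_map g x"
  by (auto simp: word_loop_def Let_def split: prod.split)

text \<open>The \<open>n\<close>-th power wraps each side once around the circle with the same
  parametrisation. On a closed side the coordinate is therefore a polynomial in \<open>z\<close>, or
  in its conjugate for an inverse letter, and finitely many closed sides can be pasted.\<close>

lemma continuous_on_loop_coord_sphere:
  assumes "w \<noteq> []"
  shows "continuous_on (sphere 0 1) (\<lambda>z. loop_coord g (face_map w z))"
proof -
  let ?n = "length w"
  have "continuous_on (\<Union>k\<in>{..<?n}. side_point ?n k ` {0..1}) (\<lambda>z. loop_coord g (face_map w z))"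
  proof (rule continuous_on_closed_Union)
    fix k assume k: "k \<in> {..<?n}"
    show "closed (side_point ?n k ` {0..1})"
      by (intro compact_imp_closed compact_continuous_image continuous_on_side_point compact_Icc)
    let ?c = "\<lambda>z::complex. if fst (w ! k) = g then if snd (w ! k) then 1 - z ^ ?n else 1 - cnj z ^ ?n else 0"
    have pow: "side_point ?n k x ^ ?n = cis (2 * pi * x)" for x
    proof -
      have "real ?n * (2 * pi * (real k + x) / real ?n) = 2 * pi * k + 2 * pi * x"
        using assms by (simp add: nonzero_mult_div_cancel_left[of "real ?n"] flip: distrib_left)
      then have "side_point ?n k x ^ ?n = cis (2 * pi * k + 2 * pi * x)"
        by (simp add: side_point_def Complex.DeMoivre)
      then show ?thesis by (simp flip: cis_mult)
    qed
    have "?c z = loop_coord g (face_map w z)" if z: "z \<in> side_point ?n k ` {0..1}" for z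
    proof -
      obtain x where x: "0 \<le> x" "x \<le> 1" "z = side_point ?n k x" using z by auto
      have "cis (2 * pi * (1 - x)) = cnj (cis (2 * pi * x))"
        by (simp add: cis_cnj right_diff_distrib flip: cis_divide) (simp add: cis_inverse[symmetric] divide_inverse del: cis_inverse)
      then show ?thesis
        using x k pow by (auto simp: face_map_side_point letter_map_def loop_coord_edge_map simp flip: complex_cnj_power)
    qed
    note c = this
    have "continuous_on (side_point ?n k ` {0..1}) ?c"
      by (cases "fst (w ! k) = g"; cases "snd (w ! k)") (auto intro!: continuous_intros)
    then show "continuous_on (side_point ?n k ` {0..1}) (\<lambda>z. loop_coord g (face_map w z))"
      using c by (rule continuous_on_eq)
  qed simp
  moreover have "sphere 0 1 \<subseteq> (\<Union>k\<in>{..<?n}. side_point ?n k ` {0..1})"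
  proof
    fix z :: complex assume "z \<in> sphere 0 1"
    then obtain k x where "k < ?n" "0 \<le> x" "x < 1" "z = side_point ?n k x"
      using sphere_point_on_side[of z ?n] assms by auto
    then show "z \<in> (\<Union>k\<in>{..<?n}. side_point ?n k ` {0..1})" by force
  qed
  ultimately show ?thesis using continuous_on_subset by blast
qed

lemma edge_coord_face_map:
  assumes "w \<noteq> []" "z \<in> cball 0 1" "z \<noteq> 0"
  shows "edge_coord g (face_map w z) = of_real (max 0 (2 * norm z - 1)) * loop_coord g (face_map w (sgn z))"
proof -
  have "Arg2pi (sgn z) = Arg2pi z" using assms(3) by (simp add: sgn_eq)
  then have sgn: "face_map w (sgn z) = word_loop w (Arg2pi z / (2 * pi))"
    using assms(3) by (simp add: face_map_def norm_sgn)
  show ?thesis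
  proof (cases "norm z < 1")
    case True
    then show ?thesis unfolding sgn by (simp add: face_map_def edge_coord_def)
  next
    case False
    then have 1: "norm z = 1" using assms(2) by simp
    obtain g' x where "word_loop w (Arg2pi z / (2 * pi)) = edge_map g' x"
      using word_loop_eq_edge_map[OF assms(1)] by blast
    then show ?thesis unfolding sgn using 1 by (simp add: face_map_def edge_coord_edge_map)
  qed
qed

text \<open>The cut-off vanishes up to radius 1/2, so the radial projection \<open>sgn\<close>,
  discontinuous at 0, is used only where it is continuous.\<close>

lemma continuous_on_edge_coord_face_map:
  assumes "w \<noteq> []"
  shows "continuous_on (cball 0 1) (\<lambda>z. edge_coord g (face_map w z))"
proof -
  let ?A = "cball 0 1 \<inter> {z::complex. 1/2 \<le> norm z}"
  have "continuous_on (cball 0 (1/2) \<union> ?A) (\<lambda>z. edge_coord g (face_map w z))"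
  proof (rule continuous_on_closed_Un)
    have "edge_coord g (face_map w z) = 0" if "z \<in> cball 0 (1/2)" for z
      using that by (auto simp: face_map_def edge_coord_def)
    then show "continuous_on (cball 0 (1/2)) (\<lambda>z. edge_coord g (face_map w z))"
      by (metis (no_types, lifting) continuous_on_cong continuous_on_const)
    have "continuous_on ?A (\<lambda>z. of_real (max 0 (2 * norm z - 1)) * loop_coord g (face_map w (sgn z)))"
      by (intro continuous_intros continuous_on_compose2[OF continuous_on_loop_coord_sphere[OF assms]])
        (auto simp: norm_sgn)
    then show "continuous_on ?A (\<lambda>z. edge_coord g (face_map w z))"
      by (rule continuous_on_eq) (subst edge_coord_face_map[OF assms], auto)
    show "closed ?A" by (intro closed_Int closed_Collect_le continuous_intros closed_cball)
  qed simp
  moreover have "cball 0 1 \<subseteq> cball 0 (1/2) \<union> ?A" by auto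
  ultimately show ?thesis using continuous_on_subset by blast
qed

lemma Hausdorff_standard_complex:
  assumes P: "rels P \<subseteq> words_over (gens P)"
  shows "Hausdorff_space (cspace (standard_complex P))"
proof -
  let ?X = "cspace (standard_complex P)"
  have ne: "r \<noteq> []" if "r \<in> rels P" for r using P that by (auto simp: words_over_def)
  have edge: "continuous_map ?X euclidean (edge_coord g)" for g
  proof (rule continuous_map_from_standard_complex[OF P])
    fix g'
    have "continuous_on {0..1} (\<lambda>x. if g' = g then 1 - cis (2 * pi * x) else 0)"
      by (cases "g' = g") (auto intro!: continuous_intros)
    then show "continuous_on {0..1} (\<lambda>x. edge_coord g (edge_map g' x))"
      by (rule continuous_on_eq) (simp add: edge_coord_edge_map loop_coord_edge_map)
  next
    fix r assume "r \<in> rels P"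
    then show "continuous_on (cball 0 1) (\<lambda>z. edge_coord g (face_map r z))"
      by (rule continuous_on_edge_coord_face_map[OF ne])
  qed
  have face: "continuous_map ?X euclidean (face_coord w)" if "w \<in> rels P" for w
  proof (rule continuous_map_from_standard_complex[OF P])
    fix r assume "r \<in> rels P"
    have "continuous_on (cball 0 1) (\<lambda>z::complex. if r = w then (1 - norm z, (1 - norm z) *\<^sub>R z) else 0)"
      by (cases "r = w") (auto intro!: continuous_intros)
    moreover have "(if r = w then (1 - norm z, (1 - norm z) *\<^sub>R z) else 0) = face_coord w (face_map r z)"
      if "z \<in> cball 0 1" for z
    proof (cases "norm z < 1")
      case False
      obtain g x where "word_loop r (Arg2pi z / (2 * pi)) = edge_map g x"
        using word_loop_eq_edge_map[OF ne[OF \<open>r \<in> rels P\<close>]] by blast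
      then show ?thesis using False that by (auto simp: face_map_def zero_prod_def)
    qed (simp add: face_map_def face_coord_def)
    ultimately show "continuous_on (cball 0 1) (\<lambda>z. face_coord w (face_map r z))"
      by (rule continuous_on_eq)
  qed simp
  have separate: "\<exists>U V. openin ?X U \<and> openin ?X V \<and> p \<in> U \<and> q \<in> V \<and> disjnt U V"
    if h: "continuous_map ?X euclidean h" and "h p \<noteq> h q" "p \<in> topspace ?X" "q \<in> topspace ?X"
    for h :: "'a std_point \<Rightarrow> 'z::t2_space" and p q
  proof -
    obtain A B where AB: "open A" "open B" "h p \<in> A" "h q \<in> B" "A \<inter> B = {}"
      using hausdorff[OF \<open>h p \<noteq> h q\<close>] by blast
    then have "openin ?X {x \<in> topspace ?X. h x \<in> A}" "openin ?X {x \<in> topspace ?X. h x \<in> B}"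
      using openin_continuous_map_preimage[OF h] by auto
    then show ?thesis using AB that(3,4)
      by (intro exI[of _ "{x \<in> topspace ?X. h x \<in> A}"] exI[of _ "{x \<in> topspace ?X. h x \<in> B}"])
        (auto simp: disjnt_def)
  qed
  have face_sep: "face_coord w p \<noteq> face_coord w q" if p: "p = On_face w z" "norm z < 1" "p \<noteq> q" for p q w z
  proof
    assume eq: "face_coord w p = face_coord w q"
    then obtain z' where q: "q = On_face w z'" "norm z' = norm z"
      using p by (cases q) (auto simp: face_coord_def zero_prod_def split: if_splits)
    then have "(1 - norm z) *\<^sub>R z = (1 - norm z) *\<^sub>R z'"
      using eq unfolding p(1) q(1) by (simp add: face_coord_def)
    then show False using p q(1) by simp
  qed
  have edge_sep: "edge_coord g p \<noteq> edge_coord g q"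
    if "p = On_edge g x" "0 < x" "x < 1" "p \<noteq> q" "q = Base \<or> (\<exists>g' y. q = On_edge g' y \<and> 0 < y \<and> y < 1)" for p q g x
  proof -
    have inj: "x = y" if eq: "cis (2 * pi * x) = cis (2 * pi * y)" and "0 \<le> x" "x < 1" "0 \<le> y" "y < 1" for x y
    proof -
      have "Arg2pi (cis (2 * pi * x)) = 2 * pi * x" "Arg2pi (cis (2 * pi * y)) = 2 * pi * y"
        using that(2-5) by (intro Arg2pi_cis; simp)+
      then have "2 * pi * x = 2 * pi * y" unfolding eq by linarith
      then show ?thesis by simp
    qed
    have "cis (2 * pi * x) \<noteq> 1" using inj[of x 0] that by auto
    then show ?thesis
      using that(5) inj[of x] that(1-4) by (auto simp: edge_coord_def loop_coord_def split: if_splits)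
  qed
  have points: "p = Base \<or> (\<exists>g x. p = On_edge g x \<and> 0 < x \<and> x < 1) \<or> (\<exists>w z. w \<in> rels P \<and> p = On_face w z \<and> norm z < 1)"
    if "p \<in> topspace ?X" for p
    using that unfolding topspace_standard_complex[OF P]
    by (auto simp: std_cells_def split: if_splits)
  show ?thesis
    unfolding Hausdorff_space_def
  proof (intro allI impI, elim conjE)
    fix p q assume pq: "p \<in> topspace ?X" "q \<in> topspace ?X" "p \<noteq> q"
    \<comment> \<open>Points in open faces are separated by \<open>face_coord\<close>; the edge
      coordinates then only have to separate points of the 1-skeleton.\<close>
    consider w z where "w \<in> rels P" "p = On_face w z" "norm z < 1"
      | w z where "w \<in> rels P" "q = On_face w z" "norm z < 1"
      | g x where "p = On_edge g x" "0 < x" "x < 1" "q = Base \<or> (\<exists>g' y. q = On_edge g' y \<and> 0 < y \<and> y < 1)"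
      | g x where "q = On_edge g x" "0 < x" "x < 1" "p = Base \<or> (\<exists>g' y. p = On_edge g' y \<and> 0 < y \<and> y < 1)"
      using points[OF pq(1)] points[OF pq(2)] pq(3) by metis
    then show "\<exists>U V. openin ?X U \<and> openin ?X V \<and> p \<in> U \<and> q \<in> V \<and> disjnt U V"
    proof cases
      case 1
      show ?thesis by (rule separate[OF face[OF 1(1)] face_sep[OF 1(2,3) pq(3)] pq(1,2)])
    next
      case 2
      have "face_coord w p \<noteq> face_coord w q" using face_sep[OF 2(2,3), of p] pq(3) by metis
      then show ?thesis by (rule separate[OF face[OF 2(1)] _ pq(1,2)])
    next
      case 3
      show ?thesis by (rule separate[OF edge edge_sep[OF 3(1-3) pq(3) 3(4)] pq(1,2)])
    next
      case 4
      have "edge_coord g p \<noteq> edge_coord g q" using edge_sep[OF 4(1-3), of p] 4(4) pq(3) by metis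
      then show ?thesis by (rule separate[OF edge _ pq(1,2)])
    qed
  qed
qed

section \<open>Immersions of compact complexes\<close>

lemma side_point_eq_iff:
  assumes "0 < n"
  shows "side_point n k x = side_point n l y \<longleftrightarrow> (\<exists>m::int. real k + x = real l + y + real n * m)"
proof -
  have "side_point n k x = side_point n l y \<longleftrightarrow>
      (\<exists>m::int. 2 * pi * (real k + x) / real n = 2 * pi * (real l + y) / real n + 2 * pi * m)"
    unfolding side_point_def complex_eq_iff using sin_cos_eq_iff by auto
  also have "\<dots> \<longleftrightarrow> (\<exists>m::int. real k + x = real l + y + real n * m)"
  proof (rule ex_cong1)
    fix m :: int
    have "2 * pi * (real l + y) / real n + 2 * pi * m = 2 * pi * (real l + y + real n * m) / real n"
      using assms by (simp add: field_simps)
    then show "2 * pi * (real k + x) / real n = 2 * pi * (real l + y) / real n + 2 * pi * m \<longleftrightarrow>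
        real k + x = real l + y + real n * m"
      using assms by simp
  qed
  finally show ?thesis .
qed

lemma side_complement_eq_arc:
  assumes "k < n"
  shows "sphere 0 1 - side_point n k ` {0<..<1} = side_point n k ` {1..real n}"
proof
  have n: "0 < n" using assms by simp
  show "sphere 0 1 - side_point n k ` {0<..<1} \<subseteq> side_point n k ` {1..real n}"
  proof
    fix z assume z: "z \<in> sphere 0 1 - side_point n k ` {0<..<1}"
    then obtain l y where l: "l < n" "0 \<le> y" "y < 1" "z = side_point n l y"
      using sphere_point_on_side[of z n] n by auto
    \<comment> \<open>Position measured from the start of side \<open>k\<close>; the sides up to
      \<open>k\<close> itself are reached only after a full turn of length \<open>n\<close>.\<close>
    define x where "x = (if k < l then real l - real k + y else real l - real k + y + real n)"
    have "z = side_point n k x"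
      unfolding l(4) side_point_eq_iff[OF n] x_def
      by (cases "k < l") (auto intro: exI[of _ 0] exI[of _ "-1"])
    moreover have "x \<in> {1..real n}"
    proof (cases "l = k")
      case True
      then have "y = 0" using z l by (cases "y = 0") auto
      then show ?thesis using True n by (simp add: x_def)
    next
      case False
      then consider "real l \<ge> real k + 1" "k < l" | "real l + 1 \<le> real k" "\<not> k < l" by linarith
      then show ?thesis using l assms by cases (auto simp: x_def)
    qed
    ultimately show "z \<in> side_point n k ` {1..real n}" by blast
  qed
  show "side_point n k ` {1..real n} \<subseteq> sphere 0 1 - side_point n k ` {0<..<1}"
  proof -
    have no: False if xt: "x \<in> {1..real n}" "t \<in> {0<..<1}" and eq: "side_point n k x = side_point n k t" for x t
    proof -
      obtain m :: int where m: "x = t + real n * m" using eq unfolding side_point_eq_iff[OF n] by auto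
      have "1 \<le> x" "x \<le> real n" "0 < t" "t < 1" using xt by auto
      then have "real n * 0 < real n * m" "real n * m < real n * 1" using m by linarith+
      then have "0 < m" "m < 1" using n by (simp_all only: mult_less_cancel_left_pos of_nat_0_less_iff of_int_0_less_iff of_int_less_1_iff)
      then show False by simp
    qed
    show ?thesis
    proof (intro subsetI DiffI notI)
      fix z assume z: "z \<in> side_point n k ` {1..real n}"
      then show "z \<in> sphere 0 1" by auto
      assume "z \<in> side_point n k ` {0<..<1}"
      then show False using z no by fastforce
    qed
  qed
qed

text \<open>What remains of the circle is homeomorphic to an interval, possibly degenerate when
  \<open>n = 1\<close>, and hence an absolute retract.\<close>

lemma side_complement_retract:
  assumes "k < n"
  shows "(sphere 0 1 - side_point n k ` {0<..<1}) retract_of cball 0 1"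
proof -
  have n: "0 < n" using assms by simp
  let ?B = "side_point n k ` {1..real n}"
  have "inj_on (side_point n k) {1..real n}"
  proof (rule inj_onI)
    fix x y assume xy: "x \<in> {1..real n}" "y \<in> {1..real n}" "side_point n k x = side_point n k y"
    then obtain m :: int where m: "x = y + real n * m" unfolding side_point_eq_iff[OF n] by auto
    have "1 \<le> x" "x \<le> real n" "1 \<le> y" "y \<le> real n" using xy by auto
    then have "real n * m < real n * 1" "real n * (-1) < real n * m" using m by linarith+
    then have "real_of_int m < 1" "-1 < real_of_int m" using n by (simp_all only: mult_less_cancel_left_pos of_nat_0_less_iff)
    then have "m = 0" by linarith
    then show "x = y" using m by simp
  qed
  then have "{1..real n} homeomorphic ?B"
    using homeomorphic_compact[OF compact_Icc continuous_on_side_point refl] by blast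
  moreover have "AR {1..real n}" using n by (intro convex_imp_AR) auto
  ultimately have "AR ?B" using AR_homeomorphic_AR homeomorphic_sym by blast
  moreover have "closedin (top_of_set (cball 0 1)) ?B"
    by (intro closed_subset compact_imp_closed compact_continuous_image continuous_on_side_point) auto
  ultimately show ?thesis
    using AR_imp_retract side_complement_eq_arc[OF assms] by metis
qed

text \<open>The set of agreement is closed because \<open>Y\<close> is Hausdorff and open because
  \<open>f\<close> is injective near a common value.\<close>

lemma unique_lift:
  assumes S: "connected S" and Y: "Hausdorff_space Y"
    and \<alpha>: "continuous_map (top_of_set S) Y \<alpha>" and \<beta>: "continuous_map (top_of_set S) Y \<beta>"
    and f: "\<And>x. x \<in> S \<Longrightarrow> f (\<alpha> x) = f (\<beta> x)"
    and inj: "\<And>y. y \<in> topspace Y \<Longrightarrow> \<exists>U. openin Y U \<and> y \<in> U \<and> inj_on f U"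
    and x0: "x0 \<in> S" "\<alpha> x0 = \<beta> x0" and "x \<in> S"
  shows "\<alpha> x = \<beta> x"
proof -
  let ?A = "{x \<in> S. \<alpha> x = \<beta> x}"
  have "closedin (top_of_set S) ?A"
    using closedin_continuous_maps_eq[OF Y \<alpha> \<beta>] by simp
  moreover have "openin (top_of_set S) ?A"
  proof (subst openin_subopen, intro ballI)
    fix x assume x: "x \<in> ?A"
    then have "\<alpha> x \<in> topspace Y" using \<alpha> continuous_map_image_subset_topspace by fastforce
    then obtain U where U: "openin Y U" "\<alpha> x \<in> U" "inj_on f U" using inj by blast
    have "openin (top_of_set S) ({x \<in> S. \<alpha> x \<in> U} \<inter> {x \<in> S. \<beta> x \<in> U})"
      using openin_continuous_map_preimage[OF \<alpha> U(1)] openin_continuous_map_preimage[OF \<beta> U(1)]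
      by (intro openin_Int) auto
    moreover have "{x \<in> S. \<alpha> x \<in> U} \<inter> {x \<in> S. \<beta> x \<in> U} \<subseteq> ?A"
      using inj_onD[OF U(3) f] by auto
    ultimately show "\<exists>T. openin (top_of_set S) T \<and> x \<in> T \<and> T \<subseteq> ?A"
      using x U(2) by (intro exI[of _ "{x \<in> S. \<alpha> x \<in> U} \<inter> {x \<in> S. \<beta> x \<in> U}"]) auto
  qed
  ultimately have "?A = S" using S x0 unfolding connected_clopen by blast
  then show ?thesis using \<open>x \<in> S\<close> by blast
qed

section \<open>Combinatorial structure of an immersed compact complex\<close>

locale compact_immersion =
  fixes P :: "'g presentation" and Y :: "'y cell_complex" and f :: "'y \<Rightarrow> 'g std_point"
  assumes rels: "rels P \<subseteq> words_over (gens P)"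
    and finite_gens: "finite (gens P)" and finite_rels: "finite (rels P)"
    and two_complex: "is_two_complex Y"
    and compact: "compact_space (cspace Y)" and connected: "connected_space (cspace Y)"
    and immersion: "immersion Y (standard_complex P) f"
begin

abbreviation "TX \<equiv> cspace (standard_complex P)"
abbreviation "TY \<equiv> cspace Y"

lemma Hausdorff_X: "Hausdorff_space TX" by (rule Hausdorff_standard_complex[OF rels])

lemma Hausdorff_Y: "Hausdorff_space TY" using two_complex by (simp add: is_two_complex_def)

lemma continuous_f: "continuous_map TY TX f"
  using immersion by (simp add: immersion_def combinatorial_map_def)

lemma locally_injective: "y \<in> topspace TY \<Longrightarrow> \<exists>U. openin TY U \<and> y \<in> U \<and> inj_on f U"
  using immersion by (simp add: immersion_def)

lemma finite_fiber: "finite {y \<in> topspace TY. f y = x}"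
  by (rule finite_fibers_of_locally_injective[OF compact Hausdorff_X continuous_f locally_injective])

lemma image_cell: "c \<in> cells Y n \<Longrightarrow> f ` c \<in> std_cells P n"
  using immersion by (simp add: immersion_def combinatorial_map_def standard_complex_def)

lemma homeomorphic_cell: "c \<in> cells Y n \<Longrightarrow> homeomorphic_map (subtopology TY c) (subtopology TX (f ` c)) f"
  using immersion by (simp add: immersion_def combinatorial_map_def)

lemma partition: "partition_on (topspace TY) (\<Union>n. cells Y n)"
  using two_complex by (simp add: is_two_complex_def)

lemma cell_subset: "c \<in> cells Y n \<Longrightarrow> c \<subseteq> topspace TY"
  using partition unfolding partition_on_def by blast

lemma cells_disjoint: "c \<in> cells Y n \<Longrightarrow> c' \<in> cells Y m \<Longrightarrow> y \<in> c \<Longrightarrow> y \<in> c' \<Longrightarrow> c = c'"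
  using partition unfolding partition_on_def disjoint_def by blast

lemma cells_cover: "y \<in> topspace TY \<Longrightarrow> \<exists>n. \<exists>c\<in>cells Y n. y \<in> c"
  using partition unfolding partition_on_def by blast

lemma inj_on_cell: "c \<in> cells Y n \<Longrightarrow> inj_on f c"
  using homeomorphic_imp_injective_map[OF homeomorphic_cell] cell_subset
  by (metis inf.absorb2 topspace_subtopology)

text \<open>On an open cell \<open>f\<close> is a homeomorphism onto its image, so \<open>q\<close>
  lifts through its inverse, and the lift extends to the closed ball. With such lifts as new
  characteristic maps, \<open>f\<close> becomes the identity in cell coordinates.\<close>

lemma cell_lift:
  fixes D :: "'d::euclidean_space set"
  assumes c: "c \<in> cells Y n" and D: "closed D" "convex D" "interior D \<noteq> {}"
    and q: "continuous_map (top_of_set D) TX q" "q ` interior D = f ` c"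
  shows "\<exists>\<psi>. continuous_map (top_of_set D) TY \<psi> \<and> (\<forall>z\<in>D. f (\<psi> z) = q z) \<and> \<psi> ` interior D = c"
proof -
  obtain g where g: "homeomorphic_maps (subtopology TY c) (subtopology TX (f ` c)) f g"
    using homeomorphic_cell[OF c] homeomorphic_map_maps by blast
  have top: "topspace (subtopology TY c) = c" using cell_subset[OF c] by auto
  have "f ` c \<subseteq> topspace TX"
    using cell_subset[OF c] continuous_map_image_subset_topspace[OF continuous_f] by blast
  then have fg: "f (g p) = p" "g p \<in> c" if "p \<in> f ` c" for p
    using g that top unfolding homeomorphic_maps_def continuous_map_def by auto
  have gf: "g (f y) = y" if "y \<in> c" for y
    using g that top unfolding homeomorphic_maps_def by auto
  have contg: "continuous_map (subtopology TX (f ` c)) TY g"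
    using g unfolding homeomorphic_maps_def continuous_map_in_subtopology by blast
  have "continuous_map (top_of_set (interior D)) (subtopology TX (f ` c)) q"
    using continuous_map_from_subtopology_mono[OF q(1) interior_subset] q(2)
    by (auto simp: continuous_map_in_subtopology)
  then have "continuous_map (top_of_set (interior D)) TY (g \<circ> q)"
    using contg continuous_map_compose by blast
  moreover have "f ((g \<circ> q) w) = q w" if "w \<in> interior D" for w using fg(1)[of "q w"] q(2) that by auto
  ultimately obtain \<psi> where \<psi>: "continuous_map (top_of_set D) TY \<psi>" "\<And>z. z \<in> D \<Longrightarrow> f (\<psi> z) = q z"
    "\<And>w. w \<in> interior D \<Longrightarrow> \<psi> w = (g \<circ> q) w"
    using extension_of_lift_to_closure[OF D compact Hausdorff_Y Hausdorff_X continuous_f finite_fiber q(1)]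
    by metis
  have "\<psi> ` interior D = g ` q ` interior D" using \<psi>(3) by (force simp: image_iff)
  also have "\<dots> = c" unfolding q(2) image_image using gf by simp
  finally show ?thesis using \<psi> by blast
qed

lemma lifts_agree:
  fixes D :: "'d::euclidean_space set"
  assumes "convex D" "continuous_map (top_of_set D) TY \<psi>" "continuous_map (top_of_set D) TY \<psi>'"
    "\<And>z. z \<in> D \<Longrightarrow> f (\<psi> z) = f (\<psi>' z)" "z0 \<in> D" "\<psi> z0 = \<psi>' z0" "z \<in> D"
  shows "\<psi> z = \<psi>' z"
  by (rule unique_lift[OF convex_connected[OF assms(1)] Hausdorff_Y assms(2-4) locally_injective assms(5-7)])

text \<open>Vertices are points here, while the 0-cells of \<open>Y\<close> are singletons;
  \<open>cells_0\<close> reconciles the two. As a fibre over \<open>Base\<close> the set is finite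
  at once.\<close>

definition V where "V = {y \<in> topspace TY. f y = Base}"
abbreviation "E \<equiv> cells Y 1"
abbreviation "F \<equiv> cells Y 2"

definition gen :: "'y set \<Rightarrow> 'g" where
  "gen e = (SOME g. g \<in> gens P \<and> f ` e = On_edge g ` {0<..<1})"

definition edge_param :: "'y set \<Rightarrow> real \<Rightarrow> 'y" where
  "edge_param e = (SOME \<psi>. continuous_map (top_of_set {0..1}) TY \<psi> \<and>
     (\<forall>x\<in>{0..1}. f (\<psi> x) = edge_map (gen e) x) \<and> \<psi> ` {0<..<1} = e)"

definition rel :: "'y set \<Rightarrow> 'g word" where
  "rel c = (SOME r. r \<in> rels P \<and> f ` c = On_face r ` ball 0 1)"

definition face_param :: "'y set \<Rightarrow> complex \<Rightarrow> 'y" where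
  "face_param c = (SOME \<psi>. continuous_map (top_of_set (cball 0 1)) TY \<psi> \<and>
     (\<forall>z\<in>cball 0 1. f (\<psi> z) = face_map (rel c) z) \<and> \<psi> ` ball 0 1 = c)"

text \<open>Edges of \<open>Y\<close> inherit the orientation of the generator that they
  cover.\<close>

definition src :: "'y set \<Rightarrow> 'y" where "src e = edge_param e 0"
definition tgt :: "'y set \<Rightarrow> 'y" where "tgt e = edge_param e 1"

lemma gen: "gen e \<in> gens P" "f ` e = On_edge (gen e) ` {0<..<1}" if "e \<in> E"
proof -
  have "\<exists>g. g \<in> gens P \<and> f ` e = On_edge g ` {0<..<1}"
    using image_cell[OF that] by (auto simp: std_cells_def)
  then show "gen e \<in> gens P" "f ` e = On_edge (gen e) ` {0<..<1}"
    unfolding gen_def by (rule someI2_ex, blast)+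
qed

lemma rel: "rel c \<in> rels P" "f ` c = On_face (rel c) ` ball 0 1" if "c \<in> F"
proof -
  have "\<exists>r. r \<in> rels P \<and> f ` c = On_face r ` ball 0 1"
    using image_cell[OF that] by (auto simp: std_cells_def)
  then show "rel c \<in> rels P" "f ` c = On_face (rel c) ` ball 0 1"
    unfolding rel_def by (rule someI2_ex, blast)+
qed

lemma edge_param:
  assumes "e \<in> E"
  shows "continuous_map (top_of_set {0..1}) TY (edge_param e)"
    "\<And>x. x \<in> {0..1} \<Longrightarrow> f (edge_param e x) = edge_map (gen e) x"
    "edge_param e ` {0<..<1} = e"
proof -
  have "edge_map (gen e) ` interior {0..1} = f ` e"
    unfolding gen(2)[OF assms] by (intro image_cong) (auto simp: edge_map_def)
  from cell_lift[OF assms _ _ _ continuous_map_edge_map[OF rels gen(1)[OF assms]] this]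
  have "\<exists>\<psi>. continuous_map (top_of_set {0..1}) TY \<psi> \<and>
     (\<forall>x\<in>{0..1}. f (\<psi> x) = edge_map (gen e) x) \<and> \<psi> ` {0<..<1} = e" by auto
  then have "continuous_map (top_of_set {0..1}) TY (edge_param e) \<and>
     (\<forall>x\<in>{0..1}. f (edge_param e x) = edge_map (gen e) x) \<and> edge_param e ` {0<..<1} = e"
    unfolding edge_param_def by (rule someI_ex)
  then show "continuous_map (top_of_set {0..1}) TY (edge_param e)"
    "\<And>x. x \<in> {0..1} \<Longrightarrow> f (edge_param e x) = edge_map (gen e) x"
    "edge_param e ` {0<..<1} = e" by auto
qed

lemma face_param:
  assumes "c \<in> F"
  shows "continuous_map (top_of_set (cball 0 1)) TY (face_param c)"
    "\<And>z. z \<in> cball 0 1 \<Longrightarrow> f (face_param c z) = face_map (rel c) z"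
    "face_param c ` ball 0 1 = c"
proof -
  have "face_map (rel c) ` interior (cball 0 1) = f ` c"
    unfolding rel(2)[OF assms] by (intro image_cong) (auto simp: face_map_def)
  from cell_lift[OF assms _ _ _ continuous_map_face_map[OF rels rel(1)[OF assms]] this]
  have "\<exists>\<psi>. continuous_map (top_of_set (cball 0 1)) TY \<psi> \<and>
     (\<forall>z\<in>cball 0 1. f (\<psi> z) = face_map (rel c) z) \<and> \<psi> ` ball 0 1 = c" by auto
  then have "continuous_map (top_of_set (cball 0 1)) TY (face_param c) \<and>
     (\<forall>z\<in>cball 0 1. f (face_param c z) = face_map (rel c) z) \<and> face_param c ` ball 0 1 = c"
    unfolding face_param_def by (rule someI_ex)
  then show "continuous_map (top_of_set (cball 0 1)) TY (face_param c)"
    "\<And>z. z \<in> cball 0 1 \<Longrightarrow> f (face_param c z) = face_map (rel c) z"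
    "face_param c ` ball 0 1 = c" by auto
qed

lemma edge_param_in: "e \<in> E \<Longrightarrow> x \<in> {0..1} \<Longrightarrow> edge_param e x \<in> topspace TY"
  using continuous_map_image_subset_topspace[OF edge_param(1)] by fastforce

lemma src_in: "e \<in> E \<Longrightarrow> src e \<in> V" and tgt_in: "e \<in> E \<Longrightarrow> tgt e \<in> V"
  using edge_param_in edge_param(2) by (auto simp: V_def src_def tgt_def edge_map_def)

lemma edge_param_closed: "e \<in> E \<Longrightarrow> edge_param e ` {0..1} = insert (src e) (insert (tgt e) e)"
proof -
  assume "e \<in> E"
  have "{0..1} = insert 0 (insert 1 {0<..<1::real})" by auto
  then show ?thesis using edge_param(3)[OF \<open>e \<in> E\<close>] by (simp add: src_def tgt_def)
qed

text \<open>Both parametrisations lift the same path, so agreement at one parameter spreads to the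
  whole interval. The parameter may be an endpoint, which is how an edge is recovered from its
  generator and source.\<close>

lemma edge_eqI:
  assumes "e \<in> E" "e' \<in> E" "gen e = gen e'" "x \<in> {0..1}" "edge_param e x = edge_param e' x"
  shows "e = e'"
proof -
  have "f (edge_param e z) = f (edge_param e' z)" if "z \<in> {0..1}" for z
    using edge_param(2)[OF assms(1) that] edge_param(2)[OF assms(2) that] assms(3) by simp
  from lifts_agree[OF _ edge_param(1)[OF assms(1)] edge_param(1)[OF assms(2)] this assms(4,5)]
  have "edge_param e z = edge_param e' z" if "z \<in> {0..1}" for z using that by simp
  then have "edge_param e ` {0<..<1} = edge_param e' ` {0<..<1}" by (intro image_cong) auto
  then show ?thesis using edge_param(3) assms(1,2) by simp
qed

text \<open>The two-dimensional version of unique lifting. Applied at a corner \<open>z\<close>, it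
  allows at most one face per relator there, which is what embeds faces into a graph on the
  generators.\<close>

lemma face_eqI:
  assumes "c \<in> F" "c' \<in> F" "rel c = rel c'" "z \<in> cball 0 1" "face_param c z = face_param c' z"
  shows "c = c'"
proof -
  have "f (face_param c z) = f (face_param c' z)" if "z \<in> cball 0 1" for z
    using face_param(2)[OF assms(1) that] face_param(2)[OF assms(2) that] assms(3) by simp
  from lifts_agree[OF _ face_param(1)[OF assms(1)] face_param(1)[OF assms(2)] this assms(4,5)]
  have "face_param c z = face_param c' z" if "z \<in> cball 0 1" for z using that by simp
  then have "face_param c ` ball 0 1 = face_param c' ` ball 0 1" by (intro image_cong) auto
  then show ?thesis using face_param(3) assms(1,2) by simp
qed

lemma finite_V: "finite V" unfolding V_def by (rule finite_fiber)

lemma finite_E: "finite E"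
proof (rule finite_imageD)
  show "finite ((\<lambda>e. (gen e, src e)) ` E)"
    by (rule finite_subset[of _ "gens P \<times> V"]) (use gen(1) src_in finite_gens finite_V in auto)
  show "inj_on (\<lambda>e. (gen e, src e)) E"
    by (rule inj_onI) (use edge_eqI[of _ _ 0] in \<open>auto simp: src_def\<close>)
qed

lemma cells_0: "cells Y 0 = (\<lambda>y. {y}) ` V"
proof
  have single: "\<exists>y. c = {y}" if "c \<in> cells Y 0" for c
    using two_complex that unfolding is_two_complex_def by blast
  show "cells Y 0 \<subseteq> (\<lambda>y. {y}) ` V"
  proof
    fix c assume c: "c \<in> cells Y 0"
    then obtain y where y: "c = {y}" using single by blast
    then have "f y = Base" using image_cell[OF c] by (simp add: std_cells_def)
    then show "c \<in> (\<lambda>y. {y}) ` V" using y cell_subset[OF c] by (auto simp: V_def)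
  qed
  show "(\<lambda>y. {y}) ` V \<subseteq> cells Y 0"
  proof
    fix c assume "c \<in> (\<lambda>y. {y}) ` V"
    then obtain y where y: "c = {y}" "y \<in> topspace TY" "f y = Base" by (auto simp: V_def)
    obtain n d where d: "d \<in> cells Y n" "y \<in> d" using cells_cover y(2) by blast
    then have "Base \<in> f ` d" using y(3) by force
    then have "n = 0" using image_cell[OF d(1)] by (auto simp: std_cells_def split: if_splits)
    then show "c \<in> cells Y 0" using single[of d] d y(1) by auto
  qed
qed

lemma card_cells_0: "card (cells Y 0) = card V"
  unfolding cells_0 by (rule card_image) simp

text \<open>The midpoint of a side lies over the midpoint of an edge of the standard complex, hence
  in a 1-cell of \<open>Y\<close>. This determines the edge, and unique lifting extends the
  agreement from the midpoint to the entire closed side.\<close>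

lemma side_exists:
  assumes "c \<in> F" "k < length (rel c)"
  shows "\<exists>e. e \<in> E \<and> gen e = fst (rel c ! k) \<and> (\<forall>x\<in>{0..1}.
    face_param c (side_point (length (rel c)) k x) = edge_param e (if snd (rel c ! k) then x else 1 - x))"
proof -
  let ?sp = "side_point (length (rel c)) k" and ?l = "rel c ! k"
  let ?t = "\<lambda>x::real. if snd ?l then x else 1 - x"
  let ?y = "face_param c (?sp (1/2))"
  have face: "f (face_param c (?sp x)) = edge_map (fst ?l) (?t x)" if "x \<in> {0..1}" for x
    using face_param(2)[OF assms(1), of "?sp x"] face_map_side_point[OF assms(2), of x] that
    by (simp add: letter_map_def)
  have "f ?y = On_edge (fst ?l) (1/2)" using face[of "1/2"] by (simp add: edge_map_def)
  moreover have "?y \<in> topspace TY"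
    using continuous_map_image_subset_topspace[OF face_param(1)[OF assms(1)]] by auto
  then obtain n e where e: "e \<in> cells Y n" "?y \<in> e" using cells_cover by blast
  ultimately have mem: "On_edge (fst ?l) (1/2) \<in> f ` e" by force
  then have "n = 1" using image_cell[OF e(1)] by (auto simp: std_cells_def split: if_splits)
  then have "e \<in> E" using e by simp
  then have gen_e: "gen e = fst ?l" using mem gen(2) by auto
  have "edge_param e (1/2) \<in> e" using edge_param(3)[OF \<open>e \<in> E\<close>] by force
  moreover have "f (edge_param e (1/2)) = f ?y"
    using edge_param(2)[OF \<open>e \<in> E\<close>, of "1/2"] gen_e \<open>f ?y = _\<close> by (simp add: edge_map_def)
  \<comment> \<open>The parameter 1/2 is fixed by reversal, so positive and inverse letters need no
    separate treatment.\<close>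
  ultimately have half: "?y = edge_param e (?t (1/2))"
    using inj_on_cell[OF \<open>e \<in> E\<close>] e(2) by (simp add: inj_on_def)
  have "continuous_map (top_of_set {0..1}) (top_of_set (cball 0 1)) ?sp"
    using continuous_on_side_point by auto
  from continuous_map_compose[OF this face_param(1)[OF assms(1)]]
  have cont1: "continuous_map (top_of_set {0..1}) TY (\<lambda>x. face_param c (?sp x))" by (simp add: comp_def)
  have "continuous_map (top_of_set {0..1}) (top_of_set {0..1}) ?t"
    by (cases "snd ?l") (auto intro!: continuous_intros)
  from continuous_map_compose[OF this edge_param(1)[OF \<open>e \<in> E\<close>]]
  have cont2: "continuous_map (top_of_set {0..1}) TY (\<lambda>x. edge_param e (?t x))" by (simp add: comp_def)
  have "f (face_param c (?sp x)) = f (edge_param e (?t x))" if "x \<in> {0..1}" for x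
    using face[OF that] edge_param(2)[OF \<open>e \<in> E\<close>, of "?t x"] that gen_e by simp
  from lifts_agree[OF _ cont1 cont2 this _ half]
  have "face_param c (?sp x) = edge_param e (?t x)" if "x \<in> {0..1}" for x using that by simp
  then show ?thesis using \<open>e \<in> E\<close> gen_e by blast
qed

definition side :: "'y set \<Rightarrow> nat \<Rightarrow> 'y set" where
  "side c k = (SOME e. e \<in> E \<and> gen e = fst (rel c ! k) \<and> (\<forall>x\<in>{0..1}.
    face_param c (side_point (length (rel c)) k x) = edge_param e (if snd (rel c ! k) then x else 1 - x)))"

lemma side:
  assumes "c \<in> F" "k < length (rel c)"
  shows "side c k \<in> E" "gen (side c k) = fst (rel c ! k)"
    "\<And>x. x \<in> {0..1} \<Longrightarrow>
      face_param c (side_point (length (rel c)) k x) = edge_param (side c k) (if snd (rel c ! k) then x else 1 - x)"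
proof -
  note s = someI_ex[OF side_exists[OF assms], folded side_def]
  show "side c k \<in> E" "gen (side c k) = fst (rel c ! k)" using s by blast+
  show "face_param c (side_point (length (rel c)) k x) = edge_param (side c k) (if snd (rel c ! k) then x else 1 - x)"
    if "x \<in> {0..1}" for x using s that by blast
qed

lemma finite_F: "finite F"
proof (rule finite_imageD)
  \<comment> \<open>The point 1 of the circle is the corner where side 0 begins; it pins down the
    face among those with the same relator.\<close>
  have "(rel c, face_param c 1) \<in> rels P \<times> V" if "c \<in> F" for c
  proof -
    have "rel c \<in> words_over (gens P)" using rel(1)[OF that] rels by blast
    then have "0 < length (rel c)" by (simp add: words_over_def)
    then have "face_param c 1 \<in> {src (side c 0), tgt (side c 0)}"
      using side(3)[OF that, of 0 0] by (auto simp: side_point_def src_def tgt_def)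
    then show ?thesis using rel(1)[OF that] src_in tgt_in side(1)[OF that \<open>0 < _\<close>] by auto
  qed
  then have "(\<lambda>c. (rel c, face_param c 1)) ` F \<subseteq> rels P \<times> V" by (rule image_subsetI)
  then show "finite ((\<lambda>c. (rel c, face_param c 1)) ` F)"
    using finite_subset finite_rels finite_V by blast
  show "inj_on (\<lambda>c. (rel c, face_param c 1)) F"
  proof (rule inj_onI)
    fix c c' assume "c \<in> F" "c' \<in> F" "(rel c, face_param c 1) = (rel c', face_param c' 1)"
    then show "c = c'" using face_eqI[of c c' 1] by simp
  qed
qed

end

section \<open>Collapses\<close>

lemma deformation_retract_transfer:
  assumes "\<exists>r. homotopic_with (\<lambda>x. True) X X r id \<and> retraction_maps X Z r id"
  shows "contractible_space Z \<Longrightarrow> contractible_space X" "connected_space X \<Longrightarrow> connected_space Z"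
proof -
  obtain r where r: "homotopic_with (\<lambda>x. True) X X r id" "retraction_maps X Z r id" using assms by blast
  show "contractible_space X" if "contractible_space Z"
    using deformation_retract_imp_homotopy_equivalent_space[OF r] that
      homotopy_equivalent_space_contractibility by blast
  show "connected_space Z" if "connected_space X"
    using r(2) that connected_space_retraction_map_image unfolding retraction_map_def by blast
qed

section \<open>Subcomplexes, elementary collapses and connectedness\<close>

context compact_immersion
begin

definition body :: "'y set \<Rightarrow> 'y set set \<Rightarrow> 'y set set \<Rightarrow> 'y set" where
  "body V' E' F' = V' \<union> \<Union>E' \<union> \<Union>F'"

definition subcomplex :: "'y set \<Rightarrow> 'y set set \<Rightarrow> 'y set set \<Rightarrow> bool" where
  "subcomplex V' E' F' \<longleftrightarrow> V' \<subseteq> V \<and> E' \<subseteq> E \<and> F' \<subseteq> F \<and> (\<forall>e\<in>E'. src e \<in> V' \<and> tgt e \<in> V') \<and>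
     (\<forall>c\<in>F'. \<forall>k<length (rel c). side c k \<in> E')"

lemma length_rel: "c \<in> F \<Longrightarrow> 0 < length (rel c)"
proof -
  assume "c \<in> F"
  then have "rel c \<in> words_over (gens P)" using rel(1) rels by blast
  then show ?thesis by (simp add: words_over_def)
qed

lemma vertex_not_in_edge: "v \<in> V \<Longrightarrow> e \<in> E \<Longrightarrow> v \<notin> e"
proof
  assume "v \<in> V" "e \<in> E" "v \<in> e"
  then have "f v = Base" "f v \<in> On_edge (gen e) ` {0<..<1}" using gen(2)[of e] unfolding V_def by blast+
  then show False by auto
qed

lemma vertex_not_in_face: "v \<in> V \<Longrightarrow> c \<in> F \<Longrightarrow> v \<notin> c"
proof
  assume "v \<in> V" "c \<in> F" "v \<in> c"
  then have "f v = Base" "f v \<in> On_face (rel c) ` ball 0 1" using rel(2)[of c] unfolding V_def by blast+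
  then show False by auto
qed

lemma edge_face_disjoint: "e \<in> E \<Longrightarrow> c \<in> F \<Longrightarrow> y \<in> e \<Longrightarrow> y \<notin> c"
proof
  assume "e \<in> E" "c \<in> F" "y \<in> e" "y \<in> c"
  then have "f y \<in> On_edge (gen e) ` {0<..<1}" "f y \<in> On_face (rel c) ` ball 0 1"
    using gen(2)[of e] rel(2)[of c] by blast+
  then show False by auto
qed

lemma edge_param_image_subset:
  "subcomplex V' E' F' \<Longrightarrow> e \<in> E' \<Longrightarrow> edge_param e ` {0..1} \<subseteq> body V' E' F'"
proof -
  assume a: "subcomplex V' E' F'" "e \<in> E'"
  then have "e \<in> E" "src e \<in> V'" "tgt e \<in> V'" by (auto simp: subcomplex_def)
  then show ?thesis using edge_param_closed[of e] a(2) by (auto simp: body_def)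
qed

lemma face_param_side:
  assumes "c \<in> F" "k < length (rel c)" "x \<in> {0..1}"
  shows "face_param c (side_point (length (rel c)) k x) \<in> edge_param (side c k) ` {0..1}"
  using side(3)[OF assms] assms(3) by auto

lemma face_param_image_subset:
  assumes "subcomplex V' E' F'" "c \<in> F'"
  shows "face_param c ` cball 0 1 \<subseteq> body V' E' F'"
proof
  fix y assume "y \<in> face_param c ` cball 0 1"
  then obtain z where z: "z \<in> cball 0 1" "y = face_param c z" by blast
  have c: "c \<in> F" using assms by (auto simp: subcomplex_def)
  show "y \<in> body V' E' F'"
  proof (cases "norm z < 1")
    case True
    then have "y \<in> c" using face_param(3)[OF c] z(2) by force
    then show ?thesis using assms(2) by (auto simp: body_def)
  next
    case False
    then obtain k x where k: "k < length (rel c)" "0 \<le> x" "x < 1" "z = side_point (length (rel c)) k x"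
      using sphere_point_on_side[of z "length (rel c)"] z(1) length_rel[OF c] by auto
    then have "y \<in> edge_param (side c k) ` {0..1}" using face_param_side[OF c k(1), of x] z(2) by auto
    moreover have "side c k \<in> E'" using assms k(1) by (auto simp: subcomplex_def)
    ultimately show ?thesis using edge_param_image_subset[OF assms(1)] by blast
  qed
qed

lemma closedin_body:
  assumes "subcomplex V' E' F'"
  shows "closedin TY (body V' E' F')"
proof -
  have sub: "V' \<subseteq> V" "E' \<subseteq> E" "F' \<subseteq> F" using assms by (auto simp: subcomplex_def)
  have fin: "finite V'" "finite E'" "finite F'"
    using sub finite_V finite_E finite_F finite_subset by blast+
  have "body V' E' F' = V' \<union> (\<Union>e\<in>E'. edge_param e ` {0..1}) \<union> (\<Union>c\<in>F'. face_param c ` cball 0 1)"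
  proof
    have "e \<subseteq> edge_param e ` {0..1}" if "e \<in> E'" for e
    proof -
      have "e \<in> E" using that sub by blast
      then show ?thesis using edge_param_closed[of e] by auto
    qed
    then have "\<Union>E' \<subseteq> (\<Union>e\<in>E'. edge_param e ` {0..1})" by blast
    moreover have "c \<subseteq> face_param c ` cball 0 1" if "c \<in> F'" for c
    proof -
      have "c \<in> F" using that sub by blast
      then show ?thesis using face_param(3)[of c] image_mono[OF ball_subset_cball] by metis
    qed
    then have "\<Union>F' \<subseteq> (\<Union>c\<in>F'. face_param c ` cball 0 1)" by blast
    ultimately show "body V' E' F' \<subseteq> V' \<union> (\<Union>e\<in>E'. edge_param e ` {0..1}) \<union> (\<Union>c\<in>F'. face_param c ` cball 0 1)"
      unfolding body_def by auto
    show "V' \<union> (\<Union>e\<in>E'. edge_param e ` {0..1}) \<union> (\<Union>c\<in>F'. face_param c ` cball 0 1) \<subseteq> body V' E' F'"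
      using edge_param_image_subset[OF assms] face_param_image_subset[OF assms]
      by (intro Un_least UN_least) (auto simp: body_def)
  qed
  moreover have "closedin TY V'"
    using closedin_Hausdorff_finite[OF Hausdorff_Y _ fin(1)] sub(1) by (auto simp: V_def)
  moreover have "closedin TY (edge_param e ` {0..1})" if "e \<in> E'" for e
  proof (rule compactin_imp_closedin[OF Hausdorff_Y image_compactin])
    show "continuous_map (top_of_set {0..1}) TY (edge_param e)" using edge_param(1) that sub by blast
  qed (simp add: compactin_subtopology)
  then have "closedin TY (\<Union>e\<in>E'. edge_param e ` {0..1})" using fin by (intro closedin_Union) auto
  moreover have "closedin TY (face_param c ` cball 0 1)" if "c \<in> F'" for c
  proof (rule compactin_imp_closedin[OF Hausdorff_Y image_compactin])
    show "continuous_map (top_of_set (cball 0 1)) TY (face_param c)" using face_param(1) that sub by blast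
  qed (simp add: compactin_subtopology)
  then have "closedin TY (\<Union>c\<in>F'. face_param c ` cball 0 1)" using fin by (intro closedin_Union) auto
  ultimately show ?thesis by (simp add: closedin_Un)
qed

lemma body_full: "body V E F = topspace TY"
proof
  show "body V E F \<subseteq> topspace TY" using cell_subset by (auto simp: body_def V_def)
  show "topspace TY \<subseteq> body V E F"
  proof
    fix y assume "y \<in> topspace TY"
    then obtain n c where c: "c \<in> cells Y n" "y \<in> c" using cells_cover by blast
    have "cells Y n = {}" if "n > 2" using two_complex that by (simp add: is_two_complex_def)
    then have "n = 0 \<or> n = 1 \<or> n = 2" using c(1) by fastforce
    then show "y \<in> body V E F" using c cells_0 by (auto simp: body_def)
  qed
qed

lemma subcomplex_full: "subcomplex V E F"
  unfolding subcomplex_def using src_in tgt_in side(1) by blast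

text \<open>Freeness of side \<open>k\<close> means that the rest of the boundary circle stays in
  the smaller body, while the open disc and the open side are embedded and disjoint from it. The
  retraction of the disc onto the remaining arc then carries over.\<close>

lemma face_collapse:
  assumes sub: "subcomplex V' E' F'" and c: "c \<in> F'" "k < length (rel c)"
    and free: "\<forall>j<length (rel c). j \<noteq> k \<longrightarrow> side c j \<noteq> side c k"
      "\<forall>c'\<in>F' - {c}. \<forall>j<length (rel c'). side c' j \<noteq> side c k"
  defines "E'' \<equiv> E' - {side c k}" and "F'' \<equiv> F' - {c}"
  shows "subcomplex V' E'' F''"
    "\<exists>r. homotopic_with (\<lambda>x. True) (subtopology TY (body V' E' F')) (subtopology TY (body V' E' F')) r id \<and>
       retraction_maps (subtopology TY (body V' E' F')) (subtopology TY (body V' E'' F'')) r id"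
proof -
  let ?e = "side c k" and ?n = "length (rel c)"
  let ?A = "side_point ?n k ` {0<..<1}"
  let ?B = "sphere 0 1 - ?A" and ?D = "cball (0::complex) 1"
  let ?S = "body V' E'' F''"
  have cF: "c \<in> F" and sub': "V' \<subseteq> V" "E' \<subseteq> E" "F' \<subseteq> F" and eE': "?e \<in> E'"
    using sub c by (auto simp: subcomplex_def)
  have eE: "?e \<in> E" using sub' eE' by auto
  show sub'': "subcomplex V' E'' F''"
    using sub free(2) unfolding subcomplex_def E''_def F''_def by blast
  have DB: "?D - ?B = ball 0 1 \<union> ?A" by (auto simp: less_le)
  have edge_at: "face_param c (side_point ?n k x) = edge_param ?e (if snd (rel c ! k) then x else 1 - x)"
    if "x \<in> {0..1}" for x using side(3)[OF cF c(2) that] .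
  have A_image: "face_param c ` ?A = ?e"
  proof -
    have "face_param c ` ?A = edge_param ?e ` (\<lambda>x. if snd (rel c ! k) then x else 1 - x) ` {0<..<1}"
      unfolding image_image using edge_at by (intro image_cong) auto
    also have "(\<lambda>x. if snd (rel c ! k) then x else 1 - x) ` {0<..<1} = {0<..<1::real}"
    proof (cases "snd (rel c ! k)")
      case False
      have "y \<in> (\<lambda>x. 1 - x) ` {0<..<1}" if "y \<in> {0<..<1}" for y :: real
        using that by (intro image_eqI[of _ _ "1 - y"]) auto
      then show ?thesis using False by auto
    qed simp
    finally show ?thesis using edge_param(3)[OF eE] by simp
  qed
  have B_image: "face_param c ` ?B \<subseteq> ?S"
  proof
    fix y assume "y \<in> face_param c ` ?B"
    then obtain z where z: "z \<in> ?B" "y = face_param c z" by blast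
    obtain j x where j: "j < ?n" "0 \<le> x" "x < 1" "z = side_point ?n j x"
      using sphere_point_on_side[of z ?n] z(1) c(2) by (metis DiffD1 dist_0_norm gr_implies_not0 gr0I mem_sphere)
    show "y \<in> ?S"
    proof (cases "j = k")
      case True
      \<comment> \<open>\<open>z\<close> avoids the open side, so only its starting point remains.
        Both ends of the removed edge survive as vertices.\<close>
      then have "x = 0" using z(1) j by (cases "x = 0") auto
      then have "y = src ?e \<or> y = tgt ?e" using edge_at[of 0] z(2) j(4) True by (auto simp: src_def tgt_def)
      then show ?thesis using sub eE' by (auto simp: subcomplex_def body_def)
    next
      case False
      have "side c j \<in> E''" using sub c(1) j(1) free(1) False by (auto simp: subcomplex_def E''_def)
      then show ?thesis
        using edge_param_image_subset[OF sub''] face_param_side[OF cF j(1), of x] j z(2) by auto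
    qed
  qed
  \<comment> \<open>Injectivity can be checked after applying \<open>f\<close>:
    \<open>face_map\<close> distinguishes interior points from points of the open side by their
    constructors.\<close>
  have inj: "inj_on (face_param c) (?D - ?B)"
  proof (rule inj_onI)
    fix z z' assume z: "z \<in> ?D - ?B" "z' \<in> ?D - ?B" "face_param c z = face_param c z'"
    then have eq: "face_map (rel c) z = face_map (rel c) z'" using face_param(2)[OF cF] by (metis DiffD1)
    have face: "face_map (rel c) z = On_face (rel c) z" if "z \<in> ball 0 1" for z
      using that by (simp add: face_map_def)
    have edge: "\<exists>x. 0 < x \<and> x < 1 \<and> z = side_point ?n k x \<and> face_map (rel c) z =
        On_edge (fst (rel c ! k)) (if snd (rel c ! k) then x else 1 - x)" if zA: "z \<in> ?A" for z
    proof -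
      obtain x where x: "0 < x" "x < 1" "z = side_point ?n k x" using zA by auto
      then show ?thesis using face_map_side_point[OF c(2), of x]
        by (intro exI[of _ x]) (simp add: letter_map_def edge_map_def)
    qed
    consider "z \<in> ball 0 1" "z' \<in> ball 0 1" | "z \<in> ?A" "z' \<in> ball 0 1" | "z \<in> ball 0 1" "z' \<in> ?A" | "z \<in> ?A" "z' \<in> ?A"
      using z(1,2) unfolding DB by blast
    then show "z = z'"
    proof cases
      case 1 then show ?thesis using eq face by simp
    next
      case 2 then show ?thesis using eq face[OF 2(2)] edge[OF 2(1)] by auto
    next
      case 3 then show ?thesis using eq face[OF 3(1)] edge[OF 3(2)] by auto
    next
      case 4 then show ?thesis using eq edge[OF 4(1)] edge[OF 4(2)] by (auto split: if_splits)
    qed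
  qed
  have image_DB: "face_param c ` (?D - ?B) = c \<union> ?e"
    unfolding DB image_Un A_image face_param(3)[OF cF] ..
  have disj: "(c \<union> ?e) \<inter> ?S = {}"
  proof -
    have False if y: "y \<in> c \<union> ?e" "y \<in> ?S" for y
    proof -
      from y(2) consider "y \<in> V'" | e' where "e' \<in> E''" "y \<in> e'" | c' where "c' \<in> F''" "y \<in> c'"
        unfolding body_def by blast
      then show False
      proof cases
        case 1
        then show False using y(1) sub'(1) vertex_not_in_edge[OF _ eE] vertex_not_in_face[OF _ cF] by blast
      next
        case 2
        then have "e' \<in> E" "e' \<noteq> ?e" using sub'(2) by (auto simp: E''_def)
        then show False using y(1) 2(2) edge_face_disjoint[OF \<open>e' \<in> E\<close> cF] cells_disjoint[OF \<open>e' \<in> E\<close> eE] by blast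
      next
        case 3
        then have "c' \<in> F" "c' \<noteq> c" using sub'(3) by (auto simp: F''_def)
        then show False using y(1) 3(2) edge_face_disjoint[OF eE \<open>c' \<in> F\<close>] cells_disjoint[OF \<open>c' \<in> F\<close> cF] by blast
      qed
    qed
    then show ?thesis by blast
  qed
  have "body V' E' F' = ?S \<union> face_param c ` ?D"
  proof
    have "c \<union> ?e \<subseteq> face_param c ` ?D" unfolding image_DB[symmetric] by blast
    moreover have "body V' E' F' \<subseteq> ?S \<union> (c \<union> ?e)" by (auto simp: body_def E''_def F''_def)
    ultimately show "body V' E' F' \<subseteq> ?S \<union> face_param c ` ?D" by (meson Un_mono subset_refl subset_trans)
    have "?S \<subseteq> body V' E' F'" by (auto simp: body_def E''_def F''_def)
    then show "?S \<union> face_param c ` ?D \<subseteq> body V' E' F'"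
      using face_param_image_subset[OF sub c(1)] by (rule Un_least)
  qed
  moreover have "\<exists>r. homotopic_with (\<lambda>x. True) (subtopology TY (?S \<union> face_param c ` ?D)) (subtopology TY (?S \<union> face_param c ` ?D)) r id \<and>
       retraction_maps (subtopology TY (?S \<union> face_param c ` ?D)) (subtopology TY ?S) r id"
    by (rule attach_along_retract[OF Hausdorff_Y closedin_body[OF sub''] compact_cball convex_cball
          side_complement_retract[OF c(2)] face_param(1)[OF cF] B_image inj]) (unfold image_DB, rule disj)
  ultimately show "\<exists>r. homotopic_with (\<lambda>x. True) (subtopology TY (body V' E' F')) (subtopology TY (body V' E' F')) r id \<and>
       retraction_maps (subtopology TY (body V' E' F')) (subtopology TY (body V' E'' F'')) r id" by simp
qed

text \<open>The inequality of truth values is an exclusive or: \<open>e\<close> has exactly one end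
  at \<open>v\<close> and is not a loop.\<close>

lemma edge_collapse:
  assumes sub: "subcomplex V' E' {}" and e: "e \<in> E'" and v: "v \<in> V'" "(src e = v) \<noteq> (tgt e = v)"
    and free: "\<forall>e'\<in>E' - {e}. src e' \<noteq> v \<and> tgt e' \<noteq> v"
  shows "subcomplex (V' - {v}) (E' - {e}) {}"
    "\<exists>r. homotopic_with (\<lambda>x. True) (subtopology TY (body V' E' {})) (subtopology TY (body V' E' {})) r id \<and>
       retraction_maps (subtopology TY (body V' E' {})) (subtopology TY (body (V' - {v}) (E' - {e}) {})) r id"
proof -
  let ?S = "body (V' - {v}) (E' - {e}) {}"
  have sub': "V' \<subseteq> V" "E' \<subseteq> E" and eE: "e \<in> E" and ends: "src e \<in> V'" "tgt e \<in> V'"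
    using sub e by (auto simp: subcomplex_def)
  show sub'': "subcomplex (V' - {v}) (E' - {e}) {}"
    using sub free by (auto simp: subcomplex_def)
  \<comment> \<open>The parameter of the end that survives; the opposite end \<open>1 - t\<close> is
    the vertex \<open>v\<close>.\<close>
  define t where "t = (if src e = v then 1 else 0::real)"
  have t: "t \<in> {0..1}" "edge_param e t \<in> V' - {v}" "edge_param e (1 - t) = v"
    using v ends by (auto simp: t_def src_def tgt_def)
  have D_t: "{0..1} - {t} = insert (1 - t) {0<..<1}" by (auto simp: t_def)
  have image_DB: "edge_param e ` ({0..1} - {t}) = insert v e"
    unfolding D_t using edge_param(3)[OF eE] t(3) by simp
  have disj: "insert v e \<inter> ?S = {}"
  proof -
    have "v \<notin> ?S" using vertex_not_in_edge sub' v(1) by (auto simp: body_def)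
    moreover have False if y: "y \<in> e" "y \<in> ?S" for y
    proof (cases "y \<in> V'")
      case True
      then show False using y(1) vertex_not_in_edge[OF _ eE] sub'(1) by blast
    next
      case False
      then obtain e' where e': "e' \<in> E' - {e}" "y \<in> e'" using y(2) unfolding body_def by blast
      then have "e' \<in> E" using sub'(2) by blast
      then show False using y(1) e' cells_disjoint[OF \<open>e' \<in> E\<close> eE] by blast
    qed
    ultimately show ?thesis by blast
  qed
  have "body V' E' {} = ?S \<union> edge_param e ` {0..1}"
  proof
    have "insert v e \<subseteq> edge_param e ` {0..1}" unfolding image_DB[symmetric] by blast
    moreover have "body V' E' {} \<subseteq> ?S \<union> insert v e" by (auto simp: body_def)
    ultimately show "body V' E' {} \<subseteq> ?S \<union> edge_param e ` {0..1}" by (meson Un_mono subset_refl subset_trans)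
    have "?S \<subseteq> body V' E' {}" by (auto simp: body_def)
    then show "?S \<union> edge_param e ` {0..1} \<subseteq> body V' E' {}"
      using edge_param_image_subset[OF sub e] by (rule Un_least)
  qed
  moreover have "\<exists>r. homotopic_with (\<lambda>x. True) (subtopology TY (?S \<union> edge_param e ` {0..1})) (subtopology TY (?S \<union> edge_param e ` {0..1})) r id \<and>
       retraction_maps (subtopology TY (?S \<union> edge_param e ` {0..1})) (subtopology TY ?S) r id"
  proof (rule attach_along_retract[OF Hausdorff_Y closedin_body[OF sub''] compact_Icc convex_real_interval(5)
          _ edge_param(1)[OF eE]])
    show "{t} retract_of {0..1}" using t(1) by simp
    show "edge_param e ` {t} \<subseteq> ?S" using t(2) by (auto simp: body_def)
    show "inj_on (edge_param e) ({0..1} - {t})"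
    proof (rule inj_onI)
      fix x y assume xy: "x \<in> {0..1} - {t}" "y \<in> {0..1} - {t}" "edge_param e x = edge_param e y"
      then have "edge_map (gen e) x = edge_map (gen e) y" using edge_param(2)[OF eE] by (metis DiffD1)
      then show "x = y" using xy(1,2) unfolding D_t by (auto simp: edge_map_def t_def split: if_splits)
    qed
    show "edge_param e ` ({0..1} - {t}) \<inter> ?S = {}" unfolding image_DB by (rule disj)
  qed
  ultimately show "\<exists>r. homotopic_with (\<lambda>x. True) (subtopology TY (body V' E' {})) (subtopology TY (body V' E' {})) r id \<and>
       retraction_maps (subtopology TY (body V' E' {})) (subtopology TY ?S) r id" by simp
qed

text \<open>Disjoint sets of cells give disjoint closed bodies. This serves both to exclude isolated
  vertices and to turn connectedness of the space into a statement about edge ends.\<close>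

lemma connected_body_split:
  assumes "subcomplex V1 E1 F1" "subcomplex V2 E2 F2"
    and disj: "V1 \<inter> V2 = {}" "E1 \<inter> E2 = {}" "F1 \<inter> F2 = {}"
    and conn: "connected_space (subtopology TY (body (V1 \<union> V2) (E1 \<union> E2) (F1 \<union> F2)))"
  shows "body V1 E1 F1 = {} \<or> body V2 E2 F2 = {}"
proof -
  have sub: "V1 \<subseteq> V" "E1 \<subseteq> E" "F1 \<subseteq> F" "V2 \<subseteq> V" "E2 \<subseteq> E" "F2 \<subseteq> F"
    using assms(1,2) by (auto simp: subcomplex_def)
  have un: "body (V1 \<union> V2) (E1 \<union> E2) (F1 \<union> F2) = body V1 E1 F1 \<union> body V2 E2 F2"
    by (auto simp: body_def)
  have "False" if y: "y \<in> body V1 E1 F1" "y \<in> body V2 E2 F2" for y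
  proof -
    have cell: "(y \<in> V' \<and> y \<in> V) \<or> (\<exists>e\<in>E'. e \<in> E \<and> y \<in> e) \<or> (\<exists>c\<in>F'. c \<in> F \<and> y \<in> c)"
      if "y \<in> body V' E' F'" "V' \<subseteq> V" "E' \<subseteq> E" "F' \<subseteq> F" for V' E' F'
      using that unfolding body_def by blast
    show False
      using cell[OF y(1) sub(1-3)] cell[OF y(2) sub(4-6)] disj
        vertex_not_in_edge vertex_not_in_face edge_face_disjoint cells_disjoint[of _ 1 _ 1] cells_disjoint[of _ 2 _ 2]
      by (elim disjE bexE conjE) blast+
  qed
  then have "body V1 E1 F1 \<inter> body V2 E2 F2 = {}" by blast
  moreover have "closedin TY (body V1 E1 F1)" "closedin TY (body V2 E2 F2)"
    using closedin_body assms(1,2) by blast+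
  moreover have "connectedin TY (body V1 E1 F1 \<union> body V2 E2 F2)"
    using conn closedin_subset[OF \<open>closedin TY (body V1 E1 F1)\<close>] closedin_subset[OF \<open>closedin TY (body V2 E2 F2)\<close>]
    unfolding un connectedin_def by blast
  ultimately show ?thesis
    unfolding connectedin_closedin by blast
qed

text \<open>The degrees sum to twice the number of edges, so some vertex has degree below 2. Degree
  0 leaves a single point by connectedness; at degree 1 an edge collapses, and the inequality
  between the cardinalities persists. Loops count twice, so they cannot occur at degree 1.\<close>

lemma graph_contractible:
  assumes "subcomplex V' E' {}" "connected_space (subtopology TY (body V' E' {}))" "card E' < card V'"
  shows "contractible_space (subtopology TY (body V' E' {}))"
  using assms
proof (induction "card V'" arbitrary: V' E' rule: less_induct)
  case less
  have sub: "V' \<subseteq> V" "E' \<subseteq> E" and ends: "\<And>e. e \<in> E' \<Longrightarrow> src e \<in> V' \<and> tgt e \<in> V'"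
    using less.prems(1) by (auto simp: subcomplex_def)
  have fin: "finite V'" "finite E'" using sub finite_V finite_E finite_subset by blast+
  define deg where "deg v = card {e \<in> E'. src e = v} + card {e \<in> E'. tgt e = v}" for v
  have "card E' = (\<Sum>v\<in>V'. card {e \<in> E'. s e = v})" if "s ` E' \<subseteq> V'" for s
    using sum.group[OF fin(2,1) that, of "\<lambda>_. 1::nat"] by simp
  moreover have "src ` E' \<subseteq> V'" "tgt ` E' \<subseteq> V'" using ends by auto
  ultimately have "card E' = (\<Sum>v\<in>V'. card {e \<in> E'. src e = v})" "card E' = (\<Sum>v\<in>V'. card {e \<in> E'. tgt e = v})"
    by blast+
  then have "(\<Sum>v\<in>V'. deg v) = 2 * card E'" by (simp add: deg_def sum.distrib)
  moreover have "2 * card V' \<le> (\<Sum>v\<in>V'. deg v)" if "\<And>v. v \<in> V' \<Longrightarrow> 2 \<le> deg v"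
    using sum_bounded_below[of V' 2 deg] that by simp
  ultimately obtain v where v: "v \<in> V'" "deg v < 2"
    using less.prems(3) by (metis (no_types, lifting) linorder_not_less mult_less_cancel1 zero_less_numeral)
  show ?case
  proof (cases "deg v = 0")
    case True
    then have none: "src e \<noteq> v \<and> tgt e \<noteq> v" if "e \<in> E'" for e
      using that fin(2) by (auto simp: deg_def)
    have "subcomplex {v} {} {}" "subcomplex (V' - {v}) E' {}"
      using less.prems(1) v(1) none by (auto simp: subcomplex_def)
    moreover have "{v} \<union> (V' - {v}) = V'" using v(1) by blast
    ultimately have "body {v} {} {} = {} \<or> body (V' - {v}) E' {} = {}"
      using connected_body_split[of "{v}" "{}" "{}" "V' - {v}" E' "{}"] less.prems(2) by simp
    then have "body V' E' {} = {v}" using v(1) by (auto simp: body_def)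
    then show ?thesis by (simp add: contractible_space_subtopology_singleton)
  next
    case False
    then have "card {e \<in> E'. src e = v} + card {e \<in> E'. tgt e = v} = 1"
      using v(2) unfolding deg_def by linarith
    then consider "card {e \<in> E'. src e = v} = 1" "card {e \<in> E'. tgt e = v} = 0"
      | "card {e \<in> E'. src e = v} = 0" "card {e \<in> E'. tgt e = v} = 1" by linarith
    then have "\<exists>e\<in>E'. (src e = v) \<noteq> (tgt e = v) \<and> (\<forall>e'\<in>E' - {e}. src e' \<noteq> v \<and> tgt e' \<noteq> v)"
    proof cases
      case 1
      then obtain e where "{e \<in> E'. src e = v} = {e}" by (metis card_1_singletonE)
      moreover have "{e \<in> E'. tgt e = v} = {}" using 1(2) fin(2) by simp
      ultimately show ?thesis by blast
    next
      case 2
      then obtain e where "{e \<in> E'. tgt e = v} = {e}" by (metis card_1_singletonE)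
      moreover have "{e \<in> E'. src e = v} = {}" using 2(1) fin(2) by simp
      ultimately show ?thesis by blast
    qed
    then obtain e where e: "e \<in> E'" "(src e = v) \<noteq> (tgt e = v)"
      "\<forall>e'\<in>E' - {e}. src e' \<noteq> v \<and> tgt e' \<noteq> v" by blast
    note collapse = edge_collapse[OF less.prems(1) e(1) v(1) e(2,3)]
    note transfer = deformation_retract_transfer[OF collapse(2)]
    have "Suc (card (V' - {v})) = card V'" "Suc (card (E' - {e})) = card E'"
      using fin v(1) e(1) card_Suc_Diff1 by metis+
    then have "card (V' - {v}) < card V'" "card (E' - {e}) < card (V' - {v})"
      using less.prems(3) by linarith+
    then show ?thesis
      using less.hyps[OF _ collapse(1) transfer(2)[OF less.prems(2)]] transfer(1) by blast
  qed
qed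

text \<open>Each collapse removes one edge and one face, which preserves the inequality; once no
  face is left it says that the remaining connected graph has fewer edges than vertices. Free sides
  are required for every nonempty set of faces so that collapsing never gets stuck.\<close>

lemma contractible_if_faces_collapse:
  assumes free: "\<And>F'. F' \<subseteq> F \<Longrightarrow> F' \<noteq> {} \<Longrightarrow> \<exists>c\<in>F'. \<exists>k<length (rel c).
      (\<forall>j<length (rel c). j \<noteq> k \<longrightarrow> side c j \<noteq> side c k) \<and>
      (\<forall>c'\<in>F' - {c}. \<forall>j<length (rel c'). side c' j \<noteq> side c k)"
    and "subcomplex V E' F'" "connected_space (subtopology TY (body V E' F'))" "card E' < card V + card F'"
  shows "contractible_space (subtopology TY (body V E' F'))"
  using assms(2-4)
proof (induction "card F'" arbitrary: E' F')
  case 0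
  then have "F' = {}" using finite_F finite_subset by (fastforce simp: subcomplex_def)
  then show ?case using graph_contractible 0 by simp
next
  case (Suc m)
  have sub: "E' \<subseteq> E" "F' \<subseteq> F" using Suc.prems(1) by (auto simp: subcomplex_def)
  then have fin: "finite E'" "finite F'" using finite_E finite_F finite_subset by blast+
  have "F' \<noteq> {}" using Suc.hyps(2) by auto
  from free[OF sub(2) this] obtain c k where c: "c \<in> F'" "k < length (rel c)"
    "\<forall>j<length (rel c). j \<noteq> k \<longrightarrow> side c j \<noteq> side c k"
    "\<forall>c'\<in>F' - {c}. \<forall>j<length (rel c'). side c' j \<noteq> side c k" by blast
  note collapse = face_collapse[OF Suc.prems(1) c]
  note transfer = deformation_retract_transfer[OF collapse(2)]
  have "side c k \<in> E'" using Suc.prems(1) c by (auto simp: subcomplex_def)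
  then have "Suc (card (E' - {side c k})) = card E'" using fin(1) card_Suc_Diff1 by metis
  moreover have "Suc (card (F' - {c})) = card F'" using fin(2) c(1) card_Suc_Diff1 by metis
  ultimately have "m = card (F' - {c})" "card (E' - {side c k}) < card V + card (F' - {c})"
    using Suc.hyps(2) Suc.prems(3) by linarith+
  then show ?case
    using Suc.hyps(1)[OF _ collapse(1) transfer(2)[OF Suc.prems(2)]] transfer(1) by blast
qed

lemma euler_char_le_0_or_contractible:
  assumes "card V + card F \<le> card E \<or> (\<forall>F'\<subseteq>F. F' \<noteq> {} \<longrightarrow> (\<exists>c\<in>F'. \<exists>k<length (rel c).
      (\<forall>j<length (rel c). j \<noteq> k \<longrightarrow> side c j \<noteq> side c k) \<and>
      (\<forall>c'\<in>F' - {c}. \<forall>j<length (rel c'). side c' j \<noteq> side c k)))"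
  shows "euler_char Y \<le> 0 \<or> contractible_space TY"
proof (cases "card V + card F \<le> card E")
  case True
  then show ?thesis by (simp add: euler_char_def card_cells_0)
next
  case False
  have whole: "subtopology TY (body V E F) = TY" unfolding body_full by simp
  then have "contractible_space (subtopology TY (body V E F))"
    using contractible_if_faces_collapse[OF _ subcomplex_full] False assms connected by simp
  then show ?thesis using whole by simp
qed

text \<open>A set of vertices closed under adjacency spans a subcomplex whose complementary cells
  also form a subcomplex, so connectedness of the space decides between them.\<close>

lemma vertices_connected:
  assumes W: "W \<subseteq> V" and adj: "\<And>e. e \<in> E \<Longrightarrow> src e \<in> W \<longleftrightarrow> tgt e \<in> W"
  shows "W = {} \<or> W = V"
proof -
  define E1 where "E1 = {e \<in> E. src e \<in> W}"
  define F1 where "F1 = {c \<in> F. src (side c 0) \<in> W}"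
  \<comment> \<open>Consecutive sides share a corner, so induction around the boundary puts all
    corners of a face into \<open>W\<close> or none.\<close>
  have sides: "src (side c k) \<in> W \<longleftrightarrow> src (side c 0) \<in> W" if c: "c \<in> F" and k: "k < length (rel c)" for c k
    using k
  proof (induction k)
    case (Suc k)
    let ?n = "length (rel c)"
    have k: "k < ?n" using Suc.prems by simp
    have ends: "edge_param (side c j) x \<in> W \<longleftrightarrow> src (side c j) \<in> W" if "j < ?n" "x = 0 \<or> x = 1" for j x
      using that adj[OF side(1)[OF c that(1)]] by (auto simp: src_def tgt_def)
    have "face_param c (side_point ?n k 1) = face_param c (side_point ?n (Suc k) 0)"
      using side_point_1[OF k] Suc.prems by simp
    then have "edge_param (side c k) (if snd (rel c ! k) then 1 else 0) =
        edge_param (side c (Suc k)) (if snd (rel c ! Suc k) then 0 else 1)"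
      using side(3)[OF c k, of 1] side(3)[OF c Suc.prems, of 0] by (simp cong: if_cong)
    moreover have "edge_param (side c k) (if snd (rel c ! k) then 1 else 0) \<in> W \<longleftrightarrow> src (side c k) \<in> W"
      by (rule ends[OF k]) simp
    moreover have "edge_param (side c (Suc k)) (if snd (rel c ! Suc k) then 0 else 1) \<in> W \<longleftrightarrow>
        src (side c (Suc k)) \<in> W"
      by (rule ends[OF Suc.prems]) simp
    ultimately show ?case using Suc.IH[OF k] by simp
  qed simp
  have 1: "subcomplex W E1 F1"
    unfolding subcomplex_def
  proof (intro conjI ballI allI impI)
    show "side c k \<in> E1" if "c \<in> F1" "k < length (rel c)" for c k
      using that sides side(1) unfolding E1_def F1_def by blast
  qed (use W adj in \<open>auto simp: E1_def F1_def\<close>)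
  have 2: "subcomplex (V - W) (E - E1) (F - F1)"
    unfolding subcomplex_def
  proof (intro conjI ballI allI impI)
    show "side c k \<in> E - E1" if "c \<in> F - F1" "k < length (rel c)" for c k
      using that sides side(1) unfolding E1_def F1_def by blast
  qed (use adj src_in tgt_in in \<open>auto simp: E1_def\<close>)
  have "W \<union> (V - W) = V" "E1 \<union> (E - E1) = E" "F1 \<union> (F - F1) = F"
    using W by (auto simp: E1_def F1_def)
  then have "body W E1 F1 = {} \<or> body (V - W) (E - E1) (F - F1) = {}"
    using connected_body_split[OF 1 2] connected body_full by simp
  then show ?thesis using W by (auto simp: body_def)
qed

text \<open>By \<open>face_eqI\<close>, the faces with a given corner embed into the graph \<open>G\<close> on the generators.\<close>

lemma leaf_at_corner:
  fixes G :: "('g, 'i) multigraph"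
  assumes G: "no_cycles G" "finite (medges G)"
    and i: "\<And>c. c \<in> F \<Longrightarrow> i c \<in> medges G"
      "\<And>c. c \<in> F \<Longrightarrow> mends G (i c) = {gen (a c), gen (b c)}"
      "\<And>c. c \<in> F \<Longrightarrow> gen (a c) \<in> mverts G \<and> gen (b c) \<in> mverts G"
      "\<And>c c'. c \<in> F \<Longrightarrow> c' \<in> F \<Longrightarrow> i c = i c' \<Longrightarrow> rel c = rel c'"
    and corner: "norm z = 1" "\<And>c. c \<in> F \<Longrightarrow> s (a c) = face_param c z" "\<And>c. c \<in> F \<Longrightarrow> s (b c) = face_param c z"
    and F': "F' \<subseteq> F" "F' \<noteq> {}"
  shows "\<exists>c\<in>F'. \<exists>e\<in>{a c, b c}. a c \<noteq> b c \<and> (\<forall>c'\<in>F' - {c}. a c' \<noteq> e \<and> b c' \<noteq> e)"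
proof -
  obtain c0 where c0: "c0 \<in> F'" using F'(2) by blast
  \<comment> \<open>Only faces with the same corner point as \<open>c0\<close> are compared, for
    \<open>face_eqI\<close> makes \<open>i\<close> injective on them.\<close>
  define M where "M = {c \<in> F'. face_param c z = face_param c0 z}"
  have M: "M \<subseteq> F" "c0 \<in> M" using F' c0 by (auto simp: M_def)
  have inj: "c = c'" if "c \<in> M" "c' \<in> M" "i c = i c'" for c c'
  proof (rule face_eqI)
    show "c \<in> F" "c' \<in> F" using that M by auto
    then show "rel c = rel c'" using i(4) that(3) by blast
    show "z \<in> cball 0 1" using corner(1) by simp
    show "face_param c z = face_param c' z" using that by (simp add: M_def)
  qed
  have "\<exists>e\<in>i ` M. \<exists>v\<in>mends G e. \<forall>e'\<in>i ` M - {e}. v \<notin> mends G e'"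
  proof (rule no_cycles_leaf[OF G(1)])
    show "finite (i ` M)" using finite_subset[OF M(1) finite_F] by simp
    show "i ` M \<subseteq> medges G" using i(1) M by blast
    show "i ` M \<noteq> {}" using M by blast
    show "\<exists>u\<in>mverts G. \<exists>v\<in>mverts G. mends G e = {u, v}" if "e \<in> i ` M" for e
      using that i(2,3) M(1) by blast
  qed
  then obtain c g where cM: "c \<in> M" and g: "g \<in> mends G (i c)" "\<forall>e'\<in>i ` M - {i c}. g \<notin> mends G e'"
    by blast
  have leaf: "g \<notin> mends G (i c')" if "c' \<in> M" "i c' \<noteq> i c" for c' using g(2) that by blast
  have cF: "c \<in> F" using cM M by blast
  have c: "c \<in> M" "g \<in> {gen (a c), gen (b c)}" using cM g(1) i(2)[OF cF] by simp_all
  obtain e where e: "e \<in> {a c, b c}" "gen e = g" using c(2) by blast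
  have "gen (a c) \<noteq> gen (b c)" using no_cycles_no_loop[OF G(1) i(1,2)] i(3) cF by blast
  \<comment> \<open>An edge determines its end \<open>s e\<close>, so any face using
    \<open>e\<close> at this corner has the same corner point and belongs to \<open>M\<close>, where
    the leaf condition applies.\<close>
  moreover have "a c' \<noteq> e \<and> b c' \<noteq> e" if c': "c' \<in> F' - {c}" for c'
  proof (rule ccontr)
    assume "\<not> ?thesis"
    then have ee: "e = a c' \<or> e = b c'" by blast
    have c'F: "c' \<in> F" using c' F' by blast
    have "face_param c' z = s e" using ee corner(2,3)[OF c'F] by auto
    moreover have "face_param c z = s e" using e(1) corner(2,3)[OF cF] by auto
    ultimately have c'M: "c' \<in> M" using c(1) c' by (simp add: M_def)
    then have "i c' \<noteq> i c" using inj[OF c(1) c'M] c' by auto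
    moreover have "g \<in> mends G (i c')" using ee e(2) i(2)[OF c'F] by auto
    ultimately show False using leaf[OF c'M] by blast
  qed
  moreover have "c \<in> F'" using c(1) by (simp add: M_def)
  ultimately show ?thesis using e(1) by metis
qed

end

section \<open>Labelled oriented graphs\<close>

lemma log_presentation_words:
  "is_log \<Gamma> \<Longrightarrow> rels (log_presentation \<Gamma>) \<subseteq> words_over (gens (log_presentation \<Gamma>))"
  by (auto simp: is_log_def log_presentation_def log_relator_def words_over_def Pi_iff)

locale log_immersion =
  fixes \<Gamma> :: "('v, 'e) log" and Y :: "'y cell_complex" and f
  assumes log: "is_log \<Gamma>"
    and two_complex: "is_two_complex Y"
    and compact: "compact_space (cspace Y)" and connected: "connected_space (cspace Y)"
    and immersion: "immersion Y (standard_complex (log_presentation \<Gamma>)) f"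

sublocale log_immersion \<subseteq> compact_immersion "log_presentation \<Gamma>" Y f
proof
  show "rels (log_presentation \<Gamma>) \<subseteq> words_over (gens (log_presentation \<Gamma>))"
    by (rule log_presentation_words[OF log])
  show "finite (gens (log_presentation \<Gamma>))" "finite (rels (log_presentation \<Gamma>))"
    using log by (simp_all add: log_presentation_def is_log_def)
qed (fact two_complex compact connected immersion)+

context log_immersion
begin

definition log_edge :: "'y set \<Rightarrow> 'e" where
  "log_edge c = (SOME e. e \<in> edges \<Gamma> \<and> log_relator \<Gamma> e = rel c)"

lemma log_edge: "log_edge c \<in> edges \<Gamma>" "rel c = log_relator \<Gamma> (log_edge c)" if "c \<in> F"
proof -
  have "\<exists>e. e \<in> edges \<Gamma> \<and> log_relator \<Gamma> e = rel c"
    using rel(1)[OF that] by (auto simp: log_presentation_def)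
  from someI_ex[OF this] show "log_edge c \<in> edges \<Gamma>" "rel c = log_relator \<Gamma> (log_edge c)"
    unfolding log_edge_def by simp_all
qed

lemma length_rel_4: "c \<in> F \<Longrightarrow> length (rel c) = 4"
  by (simp add: log_edge(2) log_relator_def)

lemma side_in: "c \<in> F \<Longrightarrow> k < 4 \<Longrightarrow> side c k \<in> E"
  by (rule side(1)) (simp_all add: length_rel_4)

lemma gen_side:
  assumes "c \<in> F"
  shows "gen (side c 0) = terminal \<Gamma> (log_edge c)" "gen (side c 1) = label \<Gamma> (log_edge c)"
    "gen (side c 2) = initial \<Gamma> (log_edge c)" "gen (side c 3) = label \<Gamma> (log_edge c)"
  using side(2)[OF assms] by (simp_all add: length_rel_4[OF assms] log_edge(2)[OF assms] log_relator_def)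

text \<open>Corner \<open>k\<close> is where letter \<open>k\<close> of the relator begins, and
  inverse letters run against their edges. Corner 2 is therefore the common source of the initial
  and label sides 2 and 1, and corner 0 the common target of the label and terminal sides 3 and
  0.\<close>

lemma side_ends:
  assumes c: "c \<in> F"
  shows "tgt (side c 0) = face_param c (side_point 4 0 0)" "tgt (side c 3) = face_param c (side_point 4 0 0)"
    "src (side c 0) = face_param c (side_point 4 1 0)" "tgt (side c 1) = face_param c (side_point 4 1 0)"
    "src (side c 1) = face_param c (side_point 4 2 0)" "src (side c 2) = face_param c (side_point 4 2 0)"
    "tgt (side c 2) = face_param c (side_point 4 3 0)" "src (side c 3) = face_param c (side_point 4 3 0)"
proof -
  have sign: "snd (rel c ! 0) = False" "snd (rel c ! 1) = False" "snd (rel c ! 2) = True" "snd (rel c ! 3) = True"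
    by (simp_all add: log_edge(2)[OF c] log_relator_def)
  have start: "face_param c (side_point 4 k 0) = edge_param (side c k) (if snd (rel c ! k) then 0 else 1)"
    if "k < 4" for k
    using side(3)[OF c, of k 0] that by (simp add: length_rel_4[OF c] cong: if_cong)
  have "end": "face_param c (side_point 4 (Suc k mod 4) 0) = edge_param (side c k) (if snd (rel c ! k) then 1 else 0)"
    if "k < 4" for k
    using side(3)[OF c, of k 1] that side_point_1[OF that] by (simp add: length_rel_4[OF c] cong: if_cong)
  have mod: "Suc 0 mod 4 = 1" "Suc 1 mod 4 = 2" "Suc 2 mod 4 = 3" "Suc 3 mod 4 = 0" by simp_all
  show "tgt (side c 0) = face_param c (side_point 4 0 0)" "tgt (side c 3) = face_param c (side_point 4 0 0)"
    "src (side c 0) = face_param c (side_point 4 1 0)" "tgt (side c 1) = face_param c (side_point 4 1 0)"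
    "src (side c 1) = face_param c (side_point 4 2 0)" "src (side c 2) = face_param c (side_point 4 2 0)"
    "tgt (side c 2) = face_param c (side_point 4 3 0)" "src (side c 3) = face_param c (side_point 4 3 0)"
    using start[of 0] start[of 1] start[of 2] start[of 3] "end"[of 0] "end"[of 1] "end"[of 2] "end"[of 3]
    unfolding mod sign src_def tgt_def by simp_all
qed

lemma side_corners:
  assumes "c \<in> F"
  shows "src (side c 2) = src (side c 1)" "tgt (side c 2) = src (side c 3)"
    "tgt (side c 1) = src (side c 0)" "tgt (side c 3) = tgt (side c 0)"
  unfolding side_ends[OF assms] by (rule refl)+

text \<open>From corner 2 a face is the square equating initial-label (sides 2, 3) with
  label-terminal (sides 1, 0). The two sides leaving that corner are exactly the ends of an edge of
  \<open>T_graph\<close>.\<close>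

lemma T_square_complex:
  assumes "no_cycles (T_graph \<Gamma>)"
  shows "square_complex V E F src tgt (\<lambda>c. side c 2) (\<lambda>c. side c 3) (\<lambda>c. side c 1) (\<lambda>c. side c 0)"
proof
  fix F' assume F': "F' \<subseteq> F" "F' \<noteq> {}"
  show "\<exists>c\<in>F'. \<exists>e\<in>{side c 2, side c 1}. side c 2 \<noteq> side c 1 \<and>
      (\<forall>c'\<in>F' - {c}. side c' 2 \<noteq> e \<and> side c' 1 \<noteq> e)"
  proof (rule leaf_at_corner[OF assms, of log_edge])
    show "norm (side_point 4 2 0) = 1" by simp
    show "finite (medges (T_graph \<Gamma>))" using log by (simp add: is_log_def T_graph_def)
    fix c assume c: "c \<in> F"
    show "log_edge c \<in> medges (T_graph \<Gamma>)" using log_edge(1)[OF c] by (simp add: T_graph_def)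
    show "mends (T_graph \<Gamma>) (log_edge c) = {gen (side c 2), gen (side c 1)}"
      unfolding gen_side[OF c] by (simp add: T_graph_def)
    show "gen (side c 2) \<in> mverts (T_graph \<Gamma>) \<and> gen (side c 1) \<in> mverts (T_graph \<Gamma>)"
      using gen(1)[OF side_in[OF c]] by (simp add: T_graph_def log_presentation_def)
    show "src (side c 2) = face_param c (side_point 4 2 0)" "src (side c 1) = face_param c (side_point 4 2 0)"
      by (rule side_ends[OF c])+
    show "rel c = rel c'" if "c' \<in> F" "log_edge c = log_edge c'" for c'
      using log_edge(2) c that by simp
  qed (rule F')+
next
  show "W = {} \<or> W = V" if "W \<subseteq> V" "\<And>e. e \<in> E \<Longrightarrow> src e \<in> W \<longleftrightarrow> tgt e \<in> W" for W
    using vertices_connected that by blast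
qed (rule finite_V finite_E finite_F src_in tgt_in side_in side_corners side_corners[symmetric] | assumption | simp)+

text \<open>The same square read backwards from corner 0: with \<open>src\<close> and
  \<open>tgt\<close> exchanged, the sides leaving it carry the last letters of the relation, which
  \<open>I_graph\<close> joins.\<close>

lemma I_square_complex:
  assumes "no_cycles (I_graph \<Gamma>)"
  shows "square_complex V E F tgt src (\<lambda>c. side c 3) (\<lambda>c. side c 2) (\<lambda>c. side c 0) (\<lambda>c. side c 1)"
proof
  fix F' assume F': "F' \<subseteq> F" "F' \<noteq> {}"
  show "\<exists>c\<in>F'. \<exists>e\<in>{side c 3, side c 0}. side c 3 \<noteq> side c 0 \<and>
      (\<forall>c'\<in>F' - {c}. side c' 3 \<noteq> e \<and> side c' 0 \<noteq> e)"
  proof (rule leaf_at_corner[OF assms, of log_edge])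
    show "norm (side_point 4 0 0) = 1" by simp
    show "finite (medges (I_graph \<Gamma>))" using log by (simp add: is_log_def I_graph_def)
    fix c assume c: "c \<in> F"
    show "log_edge c \<in> medges (I_graph \<Gamma>)" using log_edge(1)[OF c] by (simp add: I_graph_def)
    show "mends (I_graph \<Gamma>) (log_edge c) = {gen (side c 3), gen (side c 0)}"
      unfolding gen_side[OF c] by (simp add: I_graph_def)
    show "gen (side c 3) \<in> mverts (I_graph \<Gamma>) \<and> gen (side c 0) \<in> mverts (I_graph \<Gamma>)"
      using gen(1)[OF side_in[OF c]] by (simp add: I_graph_def log_presentation_def)
    show "tgt (side c 3) = face_param c (side_point 4 0 0)" "tgt (side c 0) = face_param c (side_point 4 0 0)"
      by (rule side_ends[OF c])+
    show "rel c = rel c'" if "c' \<in> F" "log_edge c = log_edge c'" for c'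
      using log_edge(2) c that by simp
  qed (rule F')+
next
  show "W = {} \<or> W = V" if "W \<subseteq> V" "\<And>e. e \<in> E \<Longrightarrow> tgt e \<in> W \<longleftrightarrow> src e \<in> W" for W
    using vertices_connected that by blast
qed (rule finite_V finite_E finite_F src_in tgt_in side_in side_corners side_corners[symmetric] | assumption | simp)+

text \<open>The four side maps enumerate all sides of a face, so a free edge of the square complex
  is a side index free in the sense of the collapses. Leaving the indices open lets one argument
  serve both graphs.\<close>

lemma euler_char_le_0_or_contractible_if_square_complex:
  assumes "square_complex V E F s t (\<lambda>c. side c i) (\<lambda>c. side c j) (\<lambda>c. side c k) (\<lambda>c. side c l)"
    and ijkl: "{i, j, k, l} = {..<4}"
  shows "euler_char Y \<le> 0 \<or> contractible_space TY"
proof -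
  interpret square_complex V E F s t "\<lambda>c. side c i" "\<lambda>c. side c j" "\<lambda>c. side c k" "\<lambda>c. side c l"
    by (rule assms(1))
  have sides: "(\<forall>m<length (rel c). Q m) \<longleftrightarrow> Q i \<and> Q j \<and> Q k \<and> Q l" if "c \<in> F" for c Q
    using ijkl unfolding length_rel_4[OF that] by (metis insert_iff lessThan_iff singletonD)
  \<comment> \<open>Four indices filling a set of four elements are distinct; hence the free edge
    differs from the other three sides of its own face.\<close>
  have "card {i, j, k, l} = 4" unfolding ijkl by simp
  then have distinct: "distinct [i, j, k, l]" using card_distinct[of "[i, j, k, l]"] by simp
  have "i < 4" "k < 4" using ijkl by blast+
  have "card V + card F \<le> card E \<or> (\<forall>F'\<subseteq>F. F' \<noteq> {} \<longrightarrow> (\<exists>c\<in>F'. \<exists>m<length (rel c).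
      (\<forall>n<length (rel c). n \<noteq> m \<longrightarrow> side c n \<noteq> side c m) \<and>
      (\<forall>c'\<in>F' - {c}. \<forall>n<length (rel c'). side c' n \<noteq> side c m)))"
    using card_le_or_height
  proof
    assume "\<exists>h :: 'y \<Rightarrow> int. \<forall>e\<in>E. h (t e) = h (s e) + 1"
    then obtain h :: "'y \<Rightarrow> int" where h: "\<forall>e\<in>E. h (t e) = h (s e) + 1" by blast
    show ?thesis
    proof (intro disjI2 allI impI)
      fix F' assume F': "F' \<subseteq> F" "F' \<noteq> {}"
      from free_edge[OF h F'] obtain c e where c: "c \<in> F'" "e \<in> {side c i, side c k}" "side c i \<noteq> side c k"
        "side c j \<noteq> e" "side c l \<noteq> e" "\<forall>c'\<in>F' - {c}. e \<notin> {side c' i, side c' j, side c' k, side c' l}"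
        by blast
      obtain m where m: "m \<in> {i, k}" "e = side c m" using c(2) by blast
      have cF: "c \<in> F" using c(1) F' by blast
      have "m < length (rel c)" using m(1) \<open>i < 4\<close> \<open>k < 4\<close> length_rel_4[OF cF] by auto
      moreover have "\<forall>n<length (rel c). n \<noteq> m \<longrightarrow> side c n \<noteq> side c m"
        unfolding sides[OF cF] using c(3-5) m distinct by auto
      moreover have "\<forall>n<length (rel c'). side c' n \<noteq> side c m" if "c' \<in> F' - {c}" for c'
      proof -
        have "c' \<in> F" using that F' by blast
        from sides[OF this] show ?thesis using c(6) that m(2) by auto
      qed
      ultimately show "\<exists>c\<in>F'. \<exists>m<length (rel c).
          (\<forall>n<length (rel c). n \<noteq> m \<longrightarrow> side c n \<noteq> side c m) \<and>
          (\<forall>c'\<in>F' - {c}. \<forall>n<length (rel c'). side c' n \<noteq> side c m)"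
        using c(1) by blast
    qed
  qed simp
  then show ?thesis by (rule euler_char_le_0_or_contractible)
qed

end

theorem corollary4p3:
  fixes \<Gamma> :: "('v, 'e) log"
  assumes "is_lof \<Gamma>"
    and "reduced_log \<Gamma>"
    and "no_cycles (I_graph \<Gamma>) \<or> no_cycles (T_graph \<Gamma>)"
  shows "nonpositive_immersions TYPE('y) (standard_complex (log_presentation \<Gamma>))"
  unfolding nonpositive_immersions_def
proof (intro allI impI, elim conjE)
  fix Y :: "'y cell_complex" and f
  assume "is_two_complex Y" "compact_space (cspace Y)" "connected_space (cspace Y)"
    "immersion Y (standard_complex (log_presentation \<Gamma>)) f"
  then interpret log_immersion \<Gamma> Y f
    using assms(1) by unfold_locales (simp_all add: is_lof_def)
  from assms(3) show "euler_char Y \<le> 0 \<or> contractible_space (cspace Y)"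
  proof
    assume "no_cycles (I_graph \<Gamma>)"
    then show ?thesis
      by (rule euler_char_le_0_or_contractible_if_square_complex[OF I_square_complex]) auto
  next
    assume "no_cycles (T_graph \<Gamma>)"
    then show ?thesis
      by (rule euler_char_le_0_or_contractible_if_square_complex[OF T_square_complex]) auto
  qed
qed

end
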